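(* Let $q$ be a power of a prime $p$ and let $k\ge 0$ be an integer. Let $t=\lfloor\log_p k\rfloor+1$ if $k>0$ and $t=0$ if $k=0$. Then $$\overline{\lambda}_{q,k}\ \ge\ \frac{\overline{\lambda}_{q,0}}{p^t q^k}\ >\ 0,$$ where $\overline{\lambda}_{q,k}$ denotes the mean value of the density of $k$-normal elements, $\overline{\lambda}_{q,k}=\lim_{y\to+\infty}\frac1y\sum_{1\le n\le y}\lambda_{q,k}(n)$. Moreover, if $q\ge 4$, then $\overline{\lambda}_{q,0}>1-\frac{1}{\sqrt q}-\frac1q$.
   Context: $\mathbb{F}_{q^n}$ denotes the finite field with $q^n$ elements, viewed as an $\mathbb{F}_q$-vector space of dimension $n$. For an integer $0\le k\le n$, an element $\alpha\in\mathbb{F}_{q^n}$ is called $k$-normal over $\mathbb{F}_q$ if the $\mathbb{F}_q$-vector space generated by the set $\{\alpha,\alpha^q,\ldots,\alpha^{q^{n-1}}\}$ has dimension $n-k$ (so $0$-normal elements are the usual normal elements). For integers $n\ge1$ and $k\ge 0$, $\lambda_{q,n,k}$ is the number of elements of $\mathbb{F}_{q^n}$ that are $k$-normal over $\mathbb{F}_q$ (with $\lambda_{q,n,k}=0$ if $k>n$), and $\lambda_{q,k}(n)=\lambda_{q,n,k}/q^n$. For every prime power $q$ and every integer $k\ge 0$, the limit $\overline{\lambda}_{q,k}=\lim_{y\to+\infty}\frac1y\sum_{1\le n\le y}\lambda_{q,k}(n)$ exists and is a nonnegative real number. *)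

theory Defs
  imports "HOL-Algebra.Algebraic_Closure_Type" "HOL-Number_Theory.Residues" "HOL-Library.Cardinality"
begin

text \<open>
  The ground field \<open>F_q\<close> is a type \<open>'f\<close> of sort \<open>finite_field\<close>, with \<open>q = CARD('f)\<close>. All its
  finite extensions are realised inside the algebraic closure \<open>'f alg_closure\<close>, which is an
  \<open>F_q\<close>-vector space through the embedding \<^const>\<open>to_ac\<close>.
\<close>

global_interpretation Fq: vector_space "\<lambda>(c :: 'f :: field) (x :: 'f alg_closure). to_ac c * x"
  defines Fq_span = Fq.span and Fq_dim = Fq.dim
  by standard (simp_all add: algebra_simps)

text \<open>
  For \<open>n \<ge> 1\<close> the set of roots of \<open>X^(q^n) - X\<close> in the closure is the subfield with \<open>q^n\<close>
  elements; this is verified in \<open>card_ext_field\<close> and \<open>ext_field_subfield\<close> below.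
\<close>

definition ext_field :: "nat \<Rightarrow> 'f :: finite_field alg_closure set" where
  "ext_field n = {x. x ^ (CARD('f) ^ n) = x}"

lemma range_to_ac_subset_ext_field: "range to_ac \<subseteq> (ext_field n :: 'f :: finite_field alg_closure set)"
  by (auto simp: ext_field_def finite_field_power_card_power_eq_same simp flip: to_ac_power)

lemma CARD_eq_power_imp_CHAR_eq:
  assumes "prime p" "CARD('f :: finite_field) = p ^ r"
  shows   "CHAR('f) = p"
proof -
  have "CHAR('f) dvd p ^ r"
    using CHAR_dvd_CARD[where ?'a = 'f] assms(2) by simp
  moreover have "prime CHAR('f)" 
    using prime_CHAR_semidom[where ?'a = 'f] finite_imp_CHAR_pos[where ?'a = 'f] by simp
  ultimately show ?thesis
    using assms(1) by (metis prime_dvd_power primes_dvd_imp_eq)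
qed

lemma card_ext_field:
  assumes "n \<ge> 1"
  shows   "card (ext_field n :: 'f :: finite_field alg_closure set) = CARD('f) ^ n"
proof -
  define N where "N = CARD('f) ^ n"
  have C: "CARD('f) \<ge> 2"
    using card_mono[of "UNIV :: 'f set" "{0, 1}"] by simp
  have "CARD('f) ^ 1 \<le> N"
    unfolding N_def using C assms by (intro power_increasing) auto
  hence N: "N \<ge> 2" using C by simp
  define p :: "'f alg_closure poly" where "p = monom 1 N - monom 1 1"
  have "CHAR('f) dvd N"
    unfolding N_def using assms CHAR_dvd_CARD[where ?'a = 'f]
    by (metis dvd_power dvd_trans less_le_trans zero_less_one)
  hence "of_nat N = (0 :: 'f alg_closure)"
    by (simp add: of_nat_eq_0_iff_char_dvd)
  hence der: "pderiv p = -1"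
    by (simp add: p_def pderiv_diff pderiv_monom one_pCons monom_0)
  have "degree p = N"
    unfolding p_def diff_conv_add_uminus using N
    by (subst degree_add_eq_left) (auto simp: degree_monom_eq)
  hence p0: "p \<noteq> 0" using N by auto
  have "poly p x = x ^ N - x" for x
    by (simp add: p_def poly_monom)
  hence roots: "ext_field n = {x. poly p x = 0}"
    by (auto simp: ext_field_def N_def)
  obtain A where A: "size A = degree p" "p = smult (lead_coeff p) (\<Prod>x\<in>#A. [:-x, 1:])"
    using alg_closed_imp_factorization[OF p0] by blast
  have count_le: "count A x \<le> 1" for x
  proof (rule ccontr)
    assume "\<not>count A x \<le> 1"
    hence *: "x \<in># A" "x \<in># A - {#x#}"
      by (auto simp flip: count_greater_zero_iff)
    then obtain B where "A - {#x#} = add_mset x B"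
      using multi_member_split by metis
    hence "A = add_mset x (add_mset x B)"
      using *(1) by (metis insert_DiffM)
    define l where "l = [:-x, 1:]"
    define s where "s = smult (lead_coeff p) (\<Prod>x\<in>#B. [:-x, 1:])"
    have "smult (lead_coeff p) (\<Prod>x\<in>#A. [:-x, 1:]) = l * l * s"
      unfolding l_def s_def \<open>A = _\<close>
      by (simp add: mult_ac del: mult_pCons_left mult_pCons_right)
    with A(2) have "p = l * l * s"
      by (rule trans)
    moreover have "poly (pderiv (l * l * s)) x = 0" if "poly l x = 0" for l s :: "'f alg_closure poly"
      by (simp only: pderiv_mult poly_add poly_mult that mult_zero_left mult_zero_right add_0)
    moreover have "poly l x = 0" unfolding l_def by simp
    ultimately have "poly (pderiv p) x = 0"
      by metis
    thus False by (simp add: der)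
  qed
  have "count A x = 1" if "x \<in># A" for x
    using count_le[of x] that count_greater_zero_iff[of A x] by linarith
  hence "card (set_mset A) = size A"
    by (simp add: size_multiset_overloaded_eq)
  moreover have "set_mset A = {x. poly p x = 0}"
    using p0 by (subst A(2)) (auto simp: poly_prod_mset prod_mset_zero_iff)
  ultimately show ?thesis
    using roots A(1) \<open>degree p = N\<close> N_def by simp
qed

lemma ext_field_subfield:
  fixes x y :: "'f :: finite_field alg_closure"
  assumes "prime p" "CARD('f) = p ^ r" "x \<in> ext_field n" "y \<in> ext_field n"
  shows   "x + y \<in> ext_field n" "x * y \<in> ext_field n" "-x \<in> ext_field n" "inverse x \<in> ext_field n"
proof -
  note CHAR = CARD_eq_power_imp_CHAR_eq[OF assms(1,2)]
  have *: "(u + v) ^ (CARD('f) ^ n) = u ^ (CARD('f) ^ n) + v ^ (CARD('f) ^ n)" for u v :: "'f alg_closure"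
    by (rule freshmans_dream'[where n = "r * n"]) (use assms(1,2) CHAR in \<open>simp_all add: power_mult\<close>)
  show "x + y \<in> ext_field n" using assms * by (simp add: ext_field_def)
  show "x * y \<in> ext_field n" using assms by (simp add: ext_field_def power_mult_distrib)
  show "inverse x \<in> ext_field n" using assms by (simp add: ext_field_def power_inverse)
  have "to_ac (-1) \<in> (ext_field n :: 'f alg_closure set)"
    using range_to_ac_subset_ext_field by blast
  hence "(-1) ^ (CARD('f) ^ n) = (-1 :: 'f alg_closure)"
    by (simp add: ext_field_def)
  hence "(-x) ^ (CARD('f) ^ n) = -x"
    using assms by (subst power_minus) (simp add: ext_field_def)
  thus "-x \<in> ext_field n" by (simp add: ext_field_def)
qed

lemma ext_field_1: "ext_field 1 = range (to_ac :: 'f :: finite_field \<Rightarrow> 'f alg_closure)"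
proof (rule sym, rule card_subset_eq)
  have card1: "card (ext_field 1 :: 'f alg_closure set) = CARD('f)"
    using card_ext_field[of 1, where ?'f = 'f] by simp
  show "finite (ext_field 1 :: 'f alg_closure set)"
    by (rule card_ge_0_finite) (simp only: card1 zero_less_card_finite)
  show "range to_ac \<subseteq> (ext_field 1 :: 'f alg_closure set)"
    by (rule range_to_ac_subset_ext_field)
  show "card (range (to_ac :: 'f \<Rightarrow> 'f alg_closure)) = card (ext_field 1 :: 'f alg_closure set)"
    by (simp only: card1 card_image[OF inj_to_ac])
qed

text \<open>
  The guard \<open>k \<le> n\<close> is needed because of truncated subtraction: without it, \<open>0\<close> would count as
  \<open>k\<close>-normal for \<open>k > n\<close>.
\<close>

definition k_normal :: "nat \<Rightarrow> nat \<Rightarrow> 'f :: finite_field alg_closure \<Rightarrow> bool" where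
  "k_normal n k \<alpha> \<longleftrightarrow> k \<le> n \<and> \<alpha> \<in> ext_field n \<and>
     Fq_dim (Fq_span {\<alpha> ^ (CARD('f) ^ i) | i. i < n}) = n - k"

definition num_k_normal :: "'f :: finite_field itself \<Rightarrow> nat \<Rightarrow> nat \<Rightarrow> nat" where
  "num_k_normal _ n k = card {\<alpha> :: 'f alg_closure. k_normal n k \<alpha>}"

definition k_normal_density :: "'f :: finite_field itself \<Rightarrow> nat \<Rightarrow> nat \<Rightarrow> real" where
  "k_normal_density F k n = real (num_k_normal F n k) / real (CARD('f) ^ n)"

text \<open>
  \<^const>\<open>Lim\<close> is unspecified when the averages diverge, so no inequality about it can be
  established without first proving that the averages converge.
\<close>

definition mean_k_normal_density :: "'f :: finite_field itself \<Rightarrow> nat \<Rightarrow> real" where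
  "mean_k_normal_density F k =
     Lim at_top (\<lambda>y :: real. 1 / y * (\<Sum>n | 1 \<le> n \<and> real n \<le> y. k_normal_density F k n))"

end

theory Submission
  imports
    Defs
    "HOL-Computational_Algebra.Polynomial_Factorial"
    "HOL-Number_Theory.Totient"
    "HOL-Analysis.Infinite_Products"
    "HOL-Real_Asymp.Real_Asymp"
begin

text \<open>
  Let \<open>F_q[X]\<close> act on the algebraic closure with \<open>X\<close> acting as the Frobenius. The annihilator of
  \<open>\<alpha>\<close> is generated by a monic polynomial whose degree is the dimension of the span of the
  conjugates of \<open>\<alpha>\<close>, and the kernel of \<open>f\<close> with \<open>f(0) \<noteq> 0\<close> has exactly \<open>q^deg f\<close>
  elements because the associated linearised polynomial is separable. Sieving by the prime factors,
  \<open>\<lambda>\<^bsub>q,k\<^esub>(n) = q^(-k) \<Sum>\<^bsub>g\<^esub> \<Prod>\<^bsub>P\<^esub> (1 - q^(-deg P))\<close>, where \<open>g\<close> ranges over the monic divisors of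
  \<open>X^n - 1\<close> of degree \<open>k\<close> and \<open>P\<close> over the monic irreducible polynomials with \<open>P g\<close> dividing \<open>X^n - 1\<close>.

  Restricted to \<open>deg P \<le> D\<close>, the right-hand side is periodic in \<open>n\<close> and so has a mean value. As at
  most \<open>gcd(n, q^j - 1) / j\<close> primes of degree \<open>j\<close> divide \<open>X^n - 1\<close> and the mean value of
  \<open>gcd(n, m)\<close> is \<open>O(\<surd>m)\<close>, the primes with \<open>deg P > D\<close> contribute \<open>O(q^(-D/2))\<close> to the averages,
  uniformly in their length. This gives the mean values. The same estimate bounds the mean for
  \<open>k = 0\<close> from below: positivity follows by convexity of \<open>exp\<close>, and the explicit bound from
  \<open>\<Prod>(1 - a) \<ge> 1 - \<Sum>a\<close>. For general \<open>k\<close> one keeps only the \<open>n\<close> divisible by \<open>p^t\<close> and the divisor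
  \<open>g = (X - 1)^k\<close>, using \<open>X^(p^t m) - 1 = (X^m - 1)^(p^t)\<close>.
\<close>

section \<open>The mean value of the greatest common divisor\<close>

text \<open>
  The mean value of \<open>n \<mapsto> gcd(n, m)\<close>, obtained from \<open>gcd(n, m) = \<Sum>\<^bsub>d | n, d | m\<^esub> \<phi>(d)\<close>.
\<close>

definition gcd_mean :: "nat \<Rightarrow> real" where
  "gcd_mean m = (\<Sum>d | d dvd m. real (totient d) / real d)"

lemma gcd_mean_nonneg: "gcd_mean m \<ge> 0"
  by (simp add: gcd_mean_def sum_nonneg)

lemma gcd_mean_1: "gcd_mean (Suc 0) = 1"
  by (simp add: gcd_mean_def)

lemma card_multiples_le:
  assumes "d > 0"
  shows   "real (card {n \<in> {1..N}. d dvd n}) \<le> real N / real d"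
proof -
  have "{n \<in> {1..N}. d dvd n} \<subseteq> (\<lambda>i. d * i) ` {1..N div d}"
    using assms by (auto elim!: dvdE simp: less_eq_div_iff_mult_less_eq mult.commute)
  hence "card {n \<in> {1..N}. d dvd n} \<le> card ((\<lambda>i. d * i) ` {1..N div d})"
    by (intro card_mono) auto
  also have "\<dots> \<le> N div d"
    using card_image_le[of "{1..N div d}"] by simp
  finally have "real (card {n \<in> {1..N}. d dvd n}) \<le> real (N div d)" by simp
  also have "\<dots> \<le> real N / real d" by (rule of_nat_div_le_of_nat)
  finally show ?thesis .
qed

text \<open>Expanding the gcd by Gauss's identity for the totient and exchanging the sums leaves the
  number of multiples of \<open>d\<close> up to \<open>N\<close>, which is at most
  \<open>N / d\<close>. The bound therefore holds for every \<open>N\<close>, not only in the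
  limit.\<close>

lemma sum_gcd_le:
  assumes "m > 0"
  shows   "(\<Sum>n=1..N. real (gcd n m)) \<le> real N * gcd_mean m"
proof -
  have fin: "finite {d. d dvd m}" using assms by simp
  have "real (gcd n m) = (\<Sum>d | d dvd m. if d dvd n then real (totient d) else 0)" for n
  proof -
    have "real (gcd n m) = (\<Sum>d | d dvd gcd n m. real (totient d))"
      by (subst (1) totient_divisor_sum [symmetric]) simp
    also have "{d. d dvd gcd n m} = {d \<in> {d. d dvd m}. d dvd n}" by auto
    also have "(\<Sum>d\<in>\<dots>. real (totient d)) = (\<Sum>d | d dvd m. if d dvd n then real (totient d) else 0)"
      by (rule sum.inter_filter[OF fin])
    finally show ?thesis .
  qed
  hence "(\<Sum>n=1..N. real (gcd n m)) =
           (\<Sum>d | d dvd m. \<Sum>n=1..N. if d dvd n then real (totient d) else 0)"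
    by (simp only: sum.swap[of _ _ "{1..N}"])
  also have "\<dots> = (\<Sum>d | d dvd m. real (totient d) * real (card {n \<in> {1..N}. d dvd n}))"
    by (simp add: sum.inter_filter [symmetric] mult.commute)
  also have "\<dots> \<le> (\<Sum>d | d dvd m. real (totient d) * (real N / real d))"
    using assms by (intro sum_mono mult_left_mono card_multiples_le) (auto intro!: Nat.gr0I)
  also have "\<dots> = real N * gcd_mean m"
    by (simp add: gcd_mean_def sum_distrib_left mult.commute)
  finally show ?thesis .
qed

text \<open>Divisors of \<open>a * b\<close> correspond to pairs of divisors of \<open>a\<close> and
  \<open>b\<close>, with inverse map \<open>x \<mapsto> (gcd x a, gcd x b)\<close>, and the summand
  is multiplicative on coprime arguments.\<close>

lemma gcd_mean_mult:
  assumes "coprime a b" "a > 0" "b > 0"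
  shows   "gcd_mean (a * b) = gcd_mean a * gcd_mean b"
proof -
  have gcd: "gcd (d * e) a = d" "gcd (d * e) b = e" if "d dvd a" "e dvd b" for d e
  proof -
    have "coprime a e" "coprime b d"
      using assms(1) that coprime_divisors[of a a e b] coprime_divisors[of d a b b]
      by (auto simp: coprime_commute)
    thus "gcd (d * e) a = d" "gcd (d * e) b = e"
      using that gcd_mult_left_right_cancel[of a e d] gcd_mult_left_left_cancel[of b d e]
      by (auto simp: gcd_proj1_iff)
  qed
  have "gcd_mean (a * b) =
          (\<Sum>(d, e) \<in> {d. d dvd a} \<times> {e. e dvd b}. real (totient (d * e)) / real (d * e))"
    unfolding gcd_mean_def
  proof (rule sum.reindex_bij_witness[of _ "\<lambda>(d, e). d * e" "\<lambda>x. (gcd x a, gcd x b)"])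
    fix x assume x: "x \<in> {d. d dvd a * b}"
    then obtain d e where "x = d * e" "d dvd a" "e dvd b"
      using division_decomp[of x a b] by blast
    thus "(case (gcd x a, gcd x b) of (d, e) \<Rightarrow> d * e) = x"
         "(case (gcd x a, gcd x b) of (d, e) \<Rightarrow> real (totient (d * e)) / real (d * e)) =
            real (totient x) / real x"
      using gcd by simp_all
  qed (use gcd in \<open>auto intro: mult_dvd_mono\<close>)
  also have "\<dots> = (\<Sum>(d, e) \<in> {d. d dvd a} \<times> {e. e dvd b}.
                     real (totient d) / real d * (real (totient e) / real e))"
  proof (intro sum.cong refl, clarify)
    fix d e assume "d dvd a" "e dvd b"
    hence "coprime d e" using assms(1) coprime_divisors by blast
    thus "real (totient (d * e)) / real (d * e) = real (totient d) / real d * (real (totient e) / real e)"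
      by (simp add: totient_mult_coprime)
  qed
  also have "\<dots> = gcd_mean a * gcd_mean b"
    by (simp add: gcd_mean_def sum_product sum.cartesian_product)
  finally show ?thesis .
qed

lemma gcd_mean_prime_power:
  assumes "prime p"
  shows   "gcd_mean (p ^ a) = 1 + real a * (1 - 1 / real p)"
proof -
  have p: "p > 1" using assms prime_gt_1_nat by blast
  have sum_c: "(\<Sum>i\<le>a. if i = 0 then 1 else c) = 1 + real a * c" for c :: real
    by (induction a) (simp_all add: algebra_simps)
  have "{d. d dvd p ^ a} = (\<lambda>i. p ^ i) ` {..a}"
    using divides_primepow_nat[OF assms] by auto
  moreover have "inj_on (\<lambda>i. p ^ i) {..a}"
    using p by (auto intro: inj_onI)
  ultimately have "gcd_mean (p ^ a) = (\<Sum>i\<le>a. real (totient (p ^ i)) / real (p ^ i))"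
    by (simp add: gcd_mean_def sum.reindex)
  also have "\<dots> = (\<Sum>i\<le>a. if i = 0 then 1 else 1 - 1 / real p)"
  proof (intro sum.cong refl)
    fix i show "real (totient (p ^ i)) / real (p ^ i) = (if i = 0 then 1 else 1 - 1 / real p)"
    proof (cases i)
      case (Suc j)
      have "real (totient (p ^ Suc j)) = real p ^ j * (real p - 1)"
        using p by (simp only: totient_prime_power_Suc[OF assms]) (simp add: of_nat_diff)
      thus ?thesis
        using p Suc by (simp add: field_simps)
    qed simp
  qed
  also have "\<dots> = 1 + real a * (1 - 1 / real p)"
    by (rule sum_c)
  finally show ?thesis .
qed

text \<open>Raising \<open>a\<close> by one multiplies the right side by \<open>p\<close> and the
  left side, or its majorant \<open>9 (1 + a)^2\<close> for \<open>p \<ge> 5\<close>, by no more, so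
  the smallest admissible \<open>a\<close> decides. The constant \<open>8/9\<close> is there to
  offset the ratio \<open>9/8\<close> at the prime 2; the prime power 3 has the ratio
  \<open>25/27\<close>, which just misses it.\<close>

lemma gcd_mean_prime_power_sq_le:
  assumes "prime p" "odd p" "a \<ge> 1" "p ^ a \<noteq> 3"
  shows   "9 * (gcd_mean (p ^ a))\<^sup>2 \<le> 8 * real (p ^ a)"
proof (cases "p = 3")
  case True
  with assms have "a \<ge> 2" by (cases "a = 1") auto
  \<comment> \<open>Since \<open>gcd_mean (3 ^ a) = 1 + 2 a / 3\<close>, this is the claim; the
    induction starts at \<open>a = 2\<close> with \<open>49 \<le> 72\<close>.\<close>
  hence "(3 + 2 * real a)\<^sup>2 \<le> 8 * 3 ^ a"
  proof (induction a rule: dec_induct)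
    case (step a)
    have "(3 + 2 * real (Suc a))\<^sup>2 \<le> 3 * (3 + 2 * real a)\<^sup>2"
      by (simp add: power2_eq_square algebra_simps)
    thus ?case using step.IH by simp
  qed (simp add: power2_eq_square)
  thus ?thesis
    using assms(1) True by (subst gcd_mean_prime_power) (simp_all add: power2_eq_square field_simps)
next
  case False
  have "p \<noteq> 0" "p \<noteq> 1" "p \<noteq> 2" "p \<noteq> 4" using assms(1,2) by (auto intro: Nat.gr0I)
  with False have p: "p \<ge> 5" by linarith
  have "9 * (1 + real a)\<^sup>2 \<le> 8 * 5 ^ a"
    using assms(3)
  proof (induction a rule: dec_induct)
    case (step a)
    have "(1 + real (Suc a))\<^sup>2 \<le> 5 * (1 + real a)\<^sup>2"
      by (simp add: power2_eq_square algebra_simps)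
    thus ?case using step.IH by simp
  qed (simp add: power2_eq_square)
  moreover have "5 ^ a \<le> real p ^ a" using p by (intro power_mono) auto
  moreover have "gcd_mean (p ^ a) \<le> 1 + real a"
    using assms(1) by (subst gcd_mean_prime_power) (simp_all add: mult_left_le)
  hence "(gcd_mean (p ^ a))\<^sup>2 \<le> (1 + real a)\<^sup>2"
    by (intro power_mono gcd_mean_nonneg)
  ultimately show ?thesis by simp
qed

lemma three_is_prime_nat: "prime (3 :: nat)"
  by simp

text \<open>A full prime power \<open>p ^ a\<close> is split off. If it differs from 3, it supplies
  the factor \<open>8/9\<close> and the cofactor \<open>b\<close> at most 1. If it is 3, it
  contributes \<open>25/27\<close>, and the factor \<open>8/9\<close> comes from \<open>b\<close>,
  which is prime to 3 and hence exceptional only for \<open>b = 1\<close>.\<close>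

lemma gcd_mean_odd_sq_le:
  assumes "odd m"
  shows   "(gcd_mean m)\<^sup>2 \<le> real m \<and> (m \<notin> {1, 3} \<longrightarrow> 9 * (gcd_mean m)\<^sup>2 \<le> 8 * real m)"
  using assms
proof (induction m rule: less_induct)
  case (less m)
  show ?case
  proof (cases "m = 1")
    case False
    then obtain p where p: "prime p" "p dvd m" using prime_factor_nat by blast
    have m: "m > 0" using less.prems by (auto intro: Nat.gr0I)
    obtain a b where ab: "\<not> p dvd b" "m = b * p ^ a"
      using prime_power_canonical[OF p(1) m] by blast
    have "a \<ge> 1" using ab p(2) by (cases a) auto
    have "p > 1" using p(1) prime_gt_1_nat by blast
    have "p \<le> p ^ a" using \<open>a \<ge> 1\<close> \<open>p > 1\<close> by (simp add: self_le_power)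
    hence "p ^ a > 1" using \<open>p > 1\<close> by linarith
    have odd: "odd b" "odd p" using less.prems ab(2) \<open>a \<ge> 1\<close> by auto
    hence b: "b > 0" by (auto intro: Nat.gr0I)
    have "b < m" unfolding ab(2) using b \<open>p ^ a > 1\<close> by simp
    note IH = less.IH[OF this odd(1)]
    have "coprime b (p ^ a)"
      using ab(1) prime_imp_coprime[OF p(1)] by (simp add: coprime_commute)
    hence G: "gcd_mean m = gcd_mean b * gcd_mean (p ^ a)"
      unfolding ab(2) using b \<open>p > 1\<close> by (intro gcd_mean_mult) auto
    show ?thesis
    proof (cases "p ^ a = 3")
      case True
      hence "p dvd 3" using \<open>a \<ge> 1\<close> by (metis One_nat_def Suc_le_lessD dvd_power)
      hence "p = 3" using p(1) three_is_prime_nat by (rule primes_dvd_imp_eq[rotated 2])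
      moreover have "a = 1"
        using True \<open>p = 3\<close> power_inject_exp[of "3 :: nat" a 1] by simp
      ultimately have p3: "p = 3" "a = 1" by auto
      have G3: "gcd_mean (p ^ a) = 5 / 3"
        using p(1) by (subst gcd_mean_prime_power) (simp_all add: p3)
      have eq: "(gcd_mean m)\<^sup>2 = 25 / 9 * (gcd_mean b)\<^sup>2" "real m = 3 * real b"
        unfolding G G3 using ab(2) p3 by (simp_all add: power2_eq_square)
      have "b \<noteq> 3" using ab(1) p3 by auto
      show ?thesis
      proof (cases "b = 1")
        case True
        thus ?thesis using eq ab(2) p3 by (auto simp: gcd_mean_1)
      next
        case False
        hence "9 * (gcd_mean b)\<^sup>2 \<le> 8 * real b" using IH \<open>b \<noteq> 3\<close> by auto
        thus ?thesis unfolding eq by auto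
      qed
    next
      case False
      have "9 * (gcd_mean m)\<^sup>2 = (gcd_mean b)\<^sup>2 * (9 * (gcd_mean (p ^ a))\<^sup>2)"
        unfolding G by (simp add: power_mult_distrib)
      also have "\<dots> \<le> real b * (8 * real (p ^ a))"
        by (rule mult_mono[OF conjunct1[OF IH] gcd_mean_prime_power_sq_le[OF p(1) odd(2) \<open>a \<ge> 1\<close> False]])
           simp_all
      also have "\<dots> = 8 * real m" unfolding ab(2) by simp
      finally show ?thesis by linarith
    qed
  qed (simp add: gcd_mean_1)
qed

text \<open>The power \<open>2 ^ a\<close> contributes the ratio \<open>(1 + a / 2)^2 / 2^a\<close>,
  which is at most 1 except at \<open>a = 1\<close>, where it is \<open>9/8\<close>. There the
  factor \<open>8/9\<close> of the odd part restores the bound unless \<open>b\<close> is 1 or 3,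
  that is, \<open>m\<close> is 2 or 6.\<close>

lemma gcd_mean_sq_le:
  assumes "m > 0"
  shows   "(gcd_mean m)\<^sup>2 \<le> 9 / 8 * real m" "m \<notin> {2, 6} \<Longrightarrow> (gcd_mean m)\<^sup>2 \<le> real m"
proof -
  obtain a b where ab: "\<not> 2 dvd b" "m = b * 2 ^ a"
    using prime_power_canonical[OF two_is_prime_nat assms] by blast
  have "coprime b (2 ^ a)" using ab(1) by simp
  moreover have "b > 0" using assms ab by simp
  ultimately have G: "(gcd_mean m)\<^sup>2 = (gcd_mean b)\<^sup>2 * (1 + real a / 2)\<^sup>2"
    using gcd_mean_prime_power[OF two_is_prime_nat, of a]
    by (simp add: ab(2) gcd_mean_mult power_mult_distrib)
  have b: "(gcd_mean b)\<^sup>2 \<le> real b" "b \<notin> {1, 3} \<Longrightarrow> 9 * (gcd_mean b)\<^sup>2 \<le> 8 * real b"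
    using gcd_mean_odd_sq_le[OF ab(1)] by auto
  have *: "(gcd_mean m)\<^sup>2 \<le> real m" if "a \<noteq> 1"
  proof -
    have "(1 + real a / 2)\<^sup>2 \<le> 2 ^ a"
    proof (cases "a = 0")
      case False
      with that have "a \<ge> 2" by simp
      thus ?thesis
      proof (induction a rule: dec_induct)
        case (step a)
        have "0 \<le> real a * (real a * 4)" "1 \<le> real a" using step.hyps by simp_all
        hence "4 \<le> real a * 8 + real a * (real a * 4)" by linarith
        hence "(1 + real (Suc a) / 2)\<^sup>2 \<le> 2 * (1 + real a / 2)\<^sup>2"
          by (simp add: power2_eq_square field_simps)
        thus ?case using step.IH by simp
      qed (simp add: power2_eq_square)
    qed simp
    hence "(gcd_mean b)\<^sup>2 * (1 + real a / 2)\<^sup>2 \<le> real b * 2 ^ a"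
      using b(1) by (intro mult_mono) auto
    thus ?thesis unfolding G unfolding ab(2) by simp
  qed
  have a1: "(gcd_mean m)\<^sup>2 = 9 / 4 * (gcd_mean b)\<^sup>2" "real m = 2 * real b" if "a = 1"
    unfolding G using that ab(2) by (simp_all add: power2_eq_square)
  show "(gcd_mean m)\<^sup>2 \<le> 9 / 8 * real m"
    using * a1 b(1) by (cases "a = 1") auto
  show "(gcd_mean m)\<^sup>2 \<le> real m" if "m \<notin> {2, 6}"
  proof (cases "a = 1")
    case True
    hence "b \<notin> {1, 3}" using that ab(2) by auto
    thus ?thesis using b(2) a1[OF True] by auto
  qed (use * in simp)
qed

text \<open>The exception 6 equals \<open>q - 1\<close> for \<open>q = 7\<close>. The square
  \<open>25/4\<close> exceeds 6 but not 7, so the comparison with \<open>sqrt q\<close>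
  survives.\<close>

lemma gcd_mean_6: "gcd_mean 6 = 5 / 2"
proof -
  have "coprime (2 :: nat) 3"
    by (intro primes_coprime two_is_prime_nat three_is_prime_nat) simp
  hence "gcd_mean (2 * 3) = gcd_mean 2 * gcd_mean 3"
    by (rule gcd_mean_mult) simp_all
  moreover have "gcd_mean 2 = 3 / 2"
    using gcd_mean_prime_power[OF two_is_prime_nat, of 1] by simp
  moreover have "gcd_mean 3 = 5 / 3"
    using gcd_mean_prime_power[OF three_is_prime_nat, of 1] by simp
  ultimately show ?thesis by simp
qed

section \<open>Averages of arithmetic functions\<close>

definition average :: "(nat \<Rightarrow> real) \<Rightarrow> nat \<Rightarrow> real" where
  "average f N = (\<Sum>n=1..N. f n) / real N"

lemma abs_average_diff_le:
  assumes "\<And>n. n \<ge> 1 \<Longrightarrow> \<bar>f n - g n\<bar> \<le> h n"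
  shows   "\<bar>average f N - average g N\<bar> \<le> average h N"
proof -
  have "average f N - average g N = (\<Sum>n=1..N. f n - g n) / real N"
    by (simp add: average_def sum_subtractf diff_divide_distrib)
  moreover have "\<bar>\<Sum>n=1..N. f n - g n\<bar> \<le> (\<Sum>n=1..N. h n)"
    using assms by (intro order_trans[OF sum_abs] sum_mono) simp
  ultimately show ?thesis
    by (simp add: average_def divide_right_mono)
qed

text \<open>The deviation \<open>D\<close> of the partial sums from the linear growth
  \<open>N * c\<close> is itself periodic, hence bounded, and vanishes after division by
  \<open>N\<close>.\<close>

lemma convergent_average_periodic:
  assumes "T \<ge> 1" and per: "\<And>n. n \<ge> 1 \<Longrightarrow> f (n + T) = f n"
  shows   "convergent (average f)"
proof -
  define c where "c = (\<Sum>n=1..T. f n) / real T"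
  define D where "D = (\<lambda>N. (\<Sum>n=1..N. f n) - real N * c)"
  have D_Suc: "D (Suc N) = D N + f (Suc N) - c" for N
    by (simp add: D_def algebra_simps)
  have "D (N + T) = D N" for N
  proof (induction N)
    case 0
    show ?case using assms(1) by (simp add: D_def c_def)
  next
    case (Suc N)
    thus ?case using D_Suc[of N] D_Suc[of "N + T"] per[of "Suc N"] by simp
  qed
  hence D_mult: "D (N + T * k) = D N" for N k
  proof (induction k)
    case (Suc k)
    thus ?case using \<open>\<And>N. D (N + T) = D N\<close>[of "N + T * k"] by (simp add: algebra_simps)
  qed simp
  define B where "B = (\<Sum>i<T. \<bar>D i\<bar>)"
  have bound: "\<bar>D N\<bar> \<le> B" for N
  proof -
    have "D N = D (N mod T)"
      using D_mult[of "N mod T" "N div T"] by simp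
    moreover have "\<bar>D (N mod T)\<bar> \<le> B"
      unfolding B_def using assms(1) by (intro member_le_sum) auto
    ultimately show ?thesis by simp
  qed
  have "(\<lambda>N. D N / real N) \<longlonglongrightarrow> 0"
  proof (rule Lim_null_comparison)
    show "eventually (\<lambda>N. norm (D N / real N) \<le> B / real N) sequentially"
      using bound by (intro always_eventually allI) (simp add: divide_right_mono)
    show "(\<lambda>N. B / real N) \<longlonglongrightarrow> 0" by (rule lim_const_over_n)
  qed
  hence "(\<lambda>N. c + D N / real N) \<longlonglongrightarrow> c + 0" by (intro tendsto_intros)
  moreover have "eventually (\<lambda>N. c + D N / real N = average f N) sequentially"
    using eventually_gt_at_top[of 0]
    by eventually_elim (simp add: D_def average_def field_simps)
  ultimately have "average f \<longlonglongrightarrow> c + 0"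
    by (rule Lim_transform_eventually)
  thus ?thesis by (rule convergentI)
qed

lemma convergent_uniform_approx:
  fixes a :: "nat \<Rightarrow> real"
  assumes "\<And>\<epsilon>. \<epsilon> > 0 \<Longrightarrow> \<exists>b. convergent b \<and> (\<forall>N. \<bar>a N - b N\<bar> \<le> \<epsilon>)"
  shows   "convergent a"
proof (rule Cauchy_convergent, rule metric_CauchyI)
  fix \<epsilon> :: real assume "\<epsilon> > 0"
  then obtain b where b: "convergent b" "\<And>N. \<bar>a N - b N\<bar> \<le> \<epsilon> / 4"
    using assms[of "\<epsilon> / 4"] by auto
  obtain M where M: "\<And>m n. m \<ge> M \<Longrightarrow> n \<ge> M \<Longrightarrow> dist (b m) (b n) < \<epsilon> / 4"
    using metric_CauchyD[OF convergent_Cauchy[OF b(1)], of "\<epsilon> / 4"] \<open>\<epsilon> > 0\<close> by auto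
  have "dist (a m) (a n) < \<epsilon>" if "m \<ge> M" "n \<ge> M" for m n
    using M[OF that] b(2)[of m] b(2)[of n] \<open>\<epsilon> > 0\<close> unfolding dist_real_def by linarith
  thus "\<exists>M. \<forall>m\<ge>M. \<forall>n\<ge>M. dist (a m) (a n) < \<epsilon>" by blast
qed

text \<open>The average up to a real \<open>y\<close> is the one up to its floor, times the floor of
  \<open>y\<close> over \<open>y\<close>; this factor tends to 1.\<close>

lemma average_tendsto_real:
  assumes "average f \<longlonglongrightarrow> L"
  shows   "((\<lambda>y :: real. 1 / y * (\<Sum>n | 1 \<le> n \<and> real n \<le> y. f n)) \<longlongrightarrow> L) at_top"
proof -
  have "filterlim (\<lambda>y :: real. nat \<lfloor>y\<rfloor>) sequentially at_top"
    by (rule filterlim_compose[OF filterlim_nat_sequentially filterlim_floor_sequentially])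
  from filterlim_compose[OF assms this]
  have "((\<lambda>y :: real. average f (nat \<lfloor>y\<rfloor>)) \<longlongrightarrow> L) at_top" .
  moreover have "((\<lambda>y :: real. real_of_int \<lfloor>y\<rfloor> / y) \<longlongrightarrow> 1) at_top"
    by real_asymp
  ultimately have "((\<lambda>y :: real. real_of_int \<lfloor>y\<rfloor> / y * average f (nat \<lfloor>y\<rfloor>)) \<longlongrightarrow> 1 * L) at_top"
    by (intro tendsto_mult)
  moreover have "eventually (\<lambda>y :: real. real_of_int \<lfloor>y\<rfloor> / y * average f (nat \<lfloor>y\<rfloor>) =
                   1 / y * (\<Sum>n | 1 \<le> n \<and> real n \<le> y. f n)) at_top"
    using eventually_ge_at_top[of 1]
  proof eventually_elim
    case (elim y)
    have "{n. 1 \<le> n \<and> real n \<le> y} = {1..nat \<lfloor>y\<rfloor>}"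
      using elim by (auto simp: le_nat_iff le_floor_iff)
    moreover have "real (nat \<lfloor>y\<rfloor>) = real_of_int \<lfloor>y\<rfloor>" "\<lfloor>y\<rfloor> \<ge> 1"
      using elim by (auto simp: le_floor_iff)
    ultimately show ?case by (simp add: average_def)
  qed
  ultimately show ?thesis by (simp add: Lim_transform_eventually)
qed

lemma prod_le_prod_subset:
  fixes f :: "'a \<Rightarrow> real"
  assumes "finite B" "A \<subseteq> B" "\<And>x. x \<in> B \<Longrightarrow> 0 \<le> f x \<and> f x \<le> 1"
  shows   "prod f B \<le> prod f A"
proof -
  have "prod f B = prod f (B - A) * prod f A"
    using assms(1,2) by (intro prod.subset_diff)
  also have "\<dots> \<le> 1 * prod f A"
    using assms by (intro mult_right_mono prod_le_1 prod_nonneg) auto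
  finally show ?thesis by simp
qed

text \<open>The logarithm of \<open>1 - x\<close> is at least \<open>- x - 2 x^2\<close>, and
  \<open>2 x^2 \<le> x\<close> on this interval.\<close>

lemma exp_neg_double_le:
  fixes x :: real
  assumes "0 \<le> x" "x \<le> 1 / 2"
  shows   "exp (- 2 * x) \<le> 1 - x"
proof -
  have "x\<^sup>2 \<le> x * (1 / 2)"
    unfolding power2_eq_square using assms by (intro mult_left_mono) auto
  hence "- 2 * x \<le> ln (1 - x)"
    using ln_one_minus_pos_lower_bound[OF assms] by simp
  thus ?thesis using assms by (subst (asm) ln_ge_iff) auto
qed

lemma sum_power_greaterThanAtMost_le:
  fixes x :: real
  assumes "0 \<le> x" "x < 1"
  shows   "(\<Sum>j\<in>{D<..N}. x ^ j) \<le> x ^ Suc D / (1 - x)"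
proof (cases "D \<le> N")
  case True
  hence "(1 - x) * (\<Sum>j\<in>{D<..N}. x ^ j) = x ^ Suc D - x ^ Suc N"
  proof (induction N rule: dec_induct)
    case (step N)
    have "{D<..Suc N} = insert (Suc N) {D<..N}" using step.hyps by auto
    hence "(1 - x) * (\<Sum>j\<in>{D<..Suc N}. x ^ j) =
             (1 - x) * x ^ Suc N + (1 - x) * (\<Sum>j\<in>{D<..N}. x ^ j)"
      by (simp add: distrib_left)
    also have "\<dots> = x ^ Suc D - x ^ Suc (Suc N)"
      unfolding step.IH by (simp add: left_diff_distrib)
    finally show ?case .
  qed simp
  also have "\<dots> \<le> x ^ Suc D" using assms by simp
  finally show ?thesis using assms by (simp add: field_simps)
qed (use assms in simp)

section \<open>Polynomials over a field\<close>

lemma pderiv_sum: "pderiv (\<Sum>x\<in>A. f x) = (\<Sum>x\<in>A. pderiv (f x))"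
  by (induction A rule: infinite_finite_induct) (simp_all add: pderiv_add)

text \<open>Split off a root \<open>a\<close> with quotient \<open>r\<close>. By the product rule
  \<open>r\<close> takes at \<open>a\<close> the nonzero value of the derivative of
  \<open>p\<close>, so \<open>a\<close> is no root of \<open>r\<close>, and the roots of
  \<open>r\<close> remain simple.\<close>

lemma card_roots_eq_degree:
  fixes p :: "'a :: alg_closed_field poly"
  assumes "p \<noteq> 0" and "\<And>x. poly p x = 0 \<Longrightarrow> poly (pderiv p) x \<noteq> 0"
  shows   "card {x. poly p x = 0} = degree p"
  using assms
proof (induction "degree p" arbitrary: p)
  case 0
  then obtain c where "p = [:c:]" "c \<noteq> 0"
    by (metis degree_0_id degree_eq_zeroE pCons_eq_0_iff)
  thus ?case by simp
next
  case (Suc d)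
  obtain a where a: "poly p a = 0"
    using alg_closed_imp_poly_has_root[of p] Suc.hyps(2) by auto
  then obtain r where r: "p = [:-a, 1:] * r"
    by (auto simp: poly_eq_0_iff_dvd)
  have "r \<noteq> 0" using Suc.prems(1) r by auto
  hence "degree p = Suc (degree r)"
    unfolding r by (subst degree_mult_eq) auto
  hence deg: "degree r = d" using Suc.hyps(2) by simp
  have der: "poly (pderiv p) x = poly r x + (x - a) * poly (pderiv r) x" for x
    unfolding r pderiv_mult by (simp add: pderiv_pCons algebra_simps)
  have ra: "poly r a \<noteq> 0"
    using Suc.prems(2)[OF a] der[of a] by simp
  have "card {x. poly r x = 0} = degree r"
  proof (rule Suc.hyps(1))
    fix x assume "poly r x = 0"
    hence "poly p x = 0" unfolding r by simp
    from Suc.prems(2)[OF this] show "poly (pderiv r) x \<noteq> 0"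
      using der[of x] \<open>poly r x = 0\<close> by auto
  qed (use deg \<open>r \<noteq> 0\<close> in auto)
  moreover have "{x. poly p x = 0} = insert a {x. poly r x = 0}"
    unfolding r by auto
  ultimately show ?case
    using ra poly_roots_finite[OF \<open>r \<noteq> 0\<close>] deg Suc.hyps(2) by simp
qed

text \<open>Division with remainder by a nonzero element of least degree, which is then scaled to be
  monic.\<close>

lemma poly_ideal_generator:
  fixes I :: "'a :: field poly set"
  assumes "f \<in> I" "f \<noteq> 0"
    and diff: "\<And>f g. f \<in> I \<Longrightarrow> g \<in> I \<Longrightarrow> f - g \<in> I"
    and mult: "\<And>f g. g \<in> I \<Longrightarrow> f * g \<in> I"
  obtains m where "lead_coeff m = 1" "\<And>f. f \<in> I \<longleftrightarrow> m dvd f"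
proof -
  define m0 where "m0 = arg_min degree (\<lambda>f. f \<in> I \<and> f \<noteq> 0)"
  have "(m0 \<in> I \<and> m0 \<noteq> 0) \<and> (\<forall>f. f \<in> I \<and> f \<noteq> 0 \<longrightarrow> degree m0 \<le> degree f)"
    unfolding m0_def by (rule arg_min_nat_lemma[of _ f]) (use assms(1,2) in simp)
  hence m0: "m0 \<in> I" "m0 \<noteq> 0" "\<And>f. f \<in> I \<Longrightarrow> f \<noteq> 0 \<Longrightarrow> degree m0 \<le> degree f"
    by simp_all
  have dvd: "f \<in> I \<longleftrightarrow> m0 dvd f" for f
  proof
    assume "f \<in> I"
    hence "f mod m0 \<in> I"
      using diff[of f "f div m0 * m0"] mult[OF m0(1), of "f div m0"]
      by (simp add: minus_div_mult_eq_mod)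
    hence "f mod m0 = 0"
      using m0(2,3) degree_mod_less[of m0 f] by fastforce
    thus "m0 dvd f" by (simp add: mod_eq_0_iff_dvd)
  next
    assume "m0 dvd f"
    thus "f \<in> I" using mult[OF m0(1)] by (auto elim!: dvdE simp: mult.commute)
  qed
  show ?thesis
  proof (rule that)
    show "lead_coeff (smult (inverse (lead_coeff m0)) m0) = 1"
      using m0(2) by simp
    show "f \<in> I \<longleftrightarrow> smult (inverse (lead_coeff m0)) m0 dvd f" for f
      using m0(2) dvd[of f] by (simp add: smult_dvd_iff)
  qed
qed

text \<open>The ideal generated by \<open>p\<close> and \<open>f\<close> has a generator dividing
  both. If it were not a unit, it would be associated to \<open>p\<close>, and \<open>p\<close>
  would divide \<open>f\<close>.\<close>

lemma irreducible_poly_bezout: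
  fixes p f :: "'a :: field poly"
  assumes "irreducible p" "\<not> p dvd f"
  obtains u v where "u * p + v * f = 1"
proof -
  define I where "I = {u * p + v * f | u v. True}"
  have I: "u * p + v * f \<in> I" for u v by (auto simp: I_def)
  have p: "p \<in> I" "p \<noteq> 0" and f: "f \<in> I"
    using assms(1) I[of 1 0] I[of 0 1] by auto
  have "\<exists>m. lead_coeff m = 1 \<and> (\<forall>g. g \<in> I \<longleftrightarrow> m dvd g)"
  proof (rule poly_ideal_generator[OF p])
    show "g - h \<in> I" if gh: "g \<in> I" "h \<in> I" for g h
    proof -
      from gh obtain u v u' v' where "g = u * p + v * f" "h = u' * p + v' * f"
        by (auto simp: I_def)
      hence "g - h = (u - u') * p + (v - v') * f" by (simp add: algebra_simps)
      thus ?thesis by (auto simp: I_def)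
    qed
    show "g * h \<in> I" if h: "h \<in> I" for g h
    proof -
      from h obtain u v where "h = u * p + v * f" by (auto simp: I_def)
      hence "g * h = (g * u) * p + (g * v) * f" by (simp add: algebra_simps)
      thus ?thesis by (auto simp: I_def)
    qed
  qed blast
  then obtain m where m: "lead_coeff m = 1" "\<And>g. g \<in> I \<longleftrightarrow> m dvd g" by blast
  have "m dvd p" "m dvd f" using m(2) p f by auto
  hence "is_unit m"
    using assms irreducibleD'[OF assms(1) \<open>m dvd p\<close>] by (blast intro: dvd_trans)
  hence "1 \<in> I" using m(2) by simp
  then obtain u v where "1 = u * p + v * f" unfolding I_def by blast
  thus ?thesis using that[of u v] by simp
qed

lemma monic_dvd_antisym:
  fixes f g :: "'a :: field poly"
  assumes "f dvd g" "g dvd f" "lead_coeff f = 1" "lead_coeff g = 1"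
  shows   "f = g"
proof -
  obtain h where h: "g = f * h" using assms(1) by (elim dvdE)
  have nz: "f \<noteq> 0" "g \<noteq> 0" using assms(3,4) by auto
  have "degree f = degree g"
    using dvd_imp_degree_le[OF assms(1)] dvd_imp_degree_le[OF assms(2)] nz by simp
  moreover have "h \<noteq> 0" using nz h by auto
  ultimately have "degree h = 0" using h nz by (simp add: degree_mult_eq)
  moreover have "lead_coeff h = 1" using h assms(3,4) by (simp add: lead_coeff_mult)
  ultimately have "h = 1" by (metis degree_0_id one_pCons)
  thus ?thesis using h by simp
qed

lemma monic_irreducible_dvd_eq:
  fixes P Q :: "'a :: field poly"
  assumes "irreducible P" "irreducible Q" "lead_coeff P = 1" "lead_coeff Q = 1" "P dvd Q"
  shows   "P = Q"
proof (rule monic_dvd_antisym[OF assms(5) _ assms(3,4)])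
  show "Q dvd P"
    using irreducibleD'[OF assms(2) assms(5)] irreducible_not_unit[OF assms(1)] by blast
qed

text \<open>A divisor of least positive degree is irreducible, since a proper factor would have
  smaller positive degree.\<close>

lemma exists_monic_irreducible_dvd:
  fixes f :: "'a :: field poly"
  assumes "degree f > 0"
  obtains P where "irreducible P" "lead_coeff P = 1" "P dvd f"
proof -
  define P0 where "P0 = arg_min degree (\<lambda>g. g dvd f \<and> degree g > 0)"
  have "(P0 dvd f \<and> degree P0 > 0) \<and> (\<forall>g. g dvd f \<and> degree g > 0 \<longrightarrow> degree P0 \<le> degree g)"
    unfolding P0_def by (rule arg_min_nat_lemma[of _ f]) (use assms in simp)
  hence P0: "P0 dvd f" "degree P0 > 0" "\<And>g. g dvd f \<Longrightarrow> degree g > 0 \<Longrightarrow> degree P0 \<le> degree g"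
    by simp_all
  have "P0 \<noteq> 0" using P0(2) by auto
  have irr: "irreducible P0"
  proof (rule irreducibleI)
    show "P0 \<noteq> 0" "\<not> is_unit P0"
      using P0(2) \<open>P0 \<noteq> 0\<close> by (simp_all add: is_unit_iff_degree)
    fix a b assume ab: "P0 = a * b"
    have "a \<noteq> 0" "b \<noteq> 0" using ab \<open>P0 \<noteq> 0\<close> by auto
    show "is_unit a \<or> is_unit b"
    proof (rule ccontr)
      assume "\<not> (is_unit a \<or> is_unit b)"
      hence "degree a > 0" "degree b > 0"
        using \<open>a \<noteq> 0\<close> \<open>b \<noteq> 0\<close> by (auto simp: is_unit_iff_degree)
      moreover have "a dvd f" using P0(1) ab by (metis dvd_mult_left)
      ultimately show False
        using P0(3)[of a] ab \<open>a \<noteq> 0\<close> \<open>b \<noteq> 0\<close> by (simp add: degree_mult_eq)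
    qed
  qed
  define c where "c = inverse (lead_coeff P0)"
  have c: "c \<noteq> 0" using \<open>P0 \<noteq> 0\<close> by (simp add: c_def)
  show ?thesis
  proof (rule that)
    have "smult c P0 dvd P0" "P0 dvd smult c P0"
      using c by (simp_all add: smult_dvd_iff dvd_smult)
    thus "irreducible (smult c P0)"
      using irr c by (simp add: irreducible_altdef smult_dvd_iff dvd_smult_iff)
    show "lead_coeff (smult c P0) = 1"
      using \<open>P0 \<noteq> 0\<close> by (simp add: c_def)
    show "smult c P0 dvd f"
      using c P0(1) by (simp add: smult_dvd_iff)
  qed
qed

lemma finite_polys_degree_le: "finite {f :: 'a :: {finite, zero} poly. degree f \<le> d}"
proof (rule finite_subset)
  show "{f :: 'a poly. degree f \<le> d} \<subseteq> Poly ` {xs. set xs \<subseteq> UNIV \<and> length xs \<le> Suc d}"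
  proof
    fix f :: "'a poly" assume "f \<in> {f. degree f \<le> d}"
    hence "length (coeffs f) \<le> Suc d"
      by (cases "f = 0") (auto simp: length_coeffs_degree)
    hence "coeffs f \<in> {xs. set xs \<subseteq> UNIV \<and> length xs \<le> Suc d}" by simp
    thus "f \<in> Poly ` {xs. set xs \<subseteq> UNIV \<and> length xs \<le> Suc d}"
      by (metis (no_types, lifting) Poly_coeffs image_eqI)
  qed
qed (intro finite_imageI finite_lists_length_le, simp)

lemma power_gcd_eq_1:
  fixes x :: "'a :: monoid_mult"
  assumes "x ^ a = 1" "x ^ b = 1"
  shows   "x ^ gcd a b = 1"
proof (cases "a = 0")
  case False
  then obtain u v where "a * u = b * v + gcd a b" using bezout_nat by blast
  hence "x ^ (a * u) = x ^ (b * v) * x ^ gcd a b" by (simp add: power_add)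
  thus ?thesis using assms by (simp add: power_mult)
qed (use assms in simp)

lemma card_roots_of_unity_le:
  assumes "n > 0"
  shows   "finite {x :: 'a :: idom. x ^ n = 1}" "card {x :: 'a :: idom. x ^ n = 1} \<le> n"
proof -
  define p :: "'a poly" where "p = monom 1 n - 1"
  have p: "poly p x = 0 \<longleftrightarrow> x ^ n = 1" for x by (simp add: p_def poly_monom)
  have "coeff p n = 1" using assms by (simp add: p_def)
  hence "p \<noteq> 0" by auto
  from poly_roots_finite[OF this] card_poly_roots_bound[OF this]
  have "finite {x :: 'a. x ^ n = 1}" "card {x :: 'a. x ^ n = 1} \<le> degree p" by (simp_all add: p)
  moreover have "degree p \<le> n"
    unfolding p_def by (intro degree_diff_le degree_monom_le) simp
  ultimately show "finite {x :: 'a. x ^ n = 1}" "card {x :: 'a. x ^ n = 1} \<le> n" by simp_all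
qed

section \<open>The Frobenius module structure of the closure\<close>

text \<open>Having \<open>q\<close> as a power of the characteristic makes
  \<open>x \<mapsto> x ^ (q ^ i)\<close> an iterate of the absolute Frobenius, hence
  additive.\<close>

locale finite_base_field =
  fixes F :: "'f :: finite_field itself" and q r :: nat
  assumes q_eq_CARD: "q = CARD('f)" and q_eq_power: "q = CHAR('f) ^ r"
begin

lemma q_ge_2: "q \<ge> 2"
  using card_mono[of "UNIV :: 'f set" "{0, 1}"] by (simp add: q_eq_CARD)

lemma q_pos [simp]: "q > 0"
  using q_ge_2 by simp

lemma q_neq_0 [simp]: "q \<noteq> 0"
  using q_ge_2 by simp

lemma prime_CHAR: "prime CHAR('f)"
  using prime_CHAR_semidom[where ?'a = 'f] finite_imp_CHAR_pos[where ?'a = 'f] by simp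

lemma frob_sum:
  "(\<Sum>x\<in>A. f x :: 'f alg_closure) ^ (q ^ i) = (\<Sum>x\<in>A. f x ^ (q ^ i))"
  by (rule freshmans_dream_sum'[where n = "r * i"]) (simp_all add: prime_CHAR q_eq_power power_mult)

lemma frob_add: "(x + y :: 'f alg_closure) ^ (q ^ i) = x ^ (q ^ i) + y ^ (q ^ i)"
  by (rule freshmans_dream'[where n = "r * i"]) (simp_all add: prime_CHAR q_eq_power power_mult)

lemma frob_to_ac: "(to_ac c :: 'f alg_closure) ^ (q ^ i) = to_ac c"
  by (simp add: finite_field_power_card_power_eq_same q_eq_CARD flip: to_ac_power)

lemma frob_inj:
  assumes "(x :: 'f alg_closure) ^ (q ^ i) = y ^ (q ^ i)"
  shows   "x = y"
  using frob_add[of "x - y" y i] assms by simp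

text \<open>
  The closure as an \<open>F_q[X]\<close>-module on which \<open>X\<close> acts as the Frobenius \<open>x \<mapsto> x^q\<close>.
\<close>

definition act :: "'f poly \<Rightarrow> 'f alg_closure \<Rightarrow> 'f alg_closure" where
  "act f x = (\<Sum>i\<le>degree f. to_ac (coeff f i) * x ^ (q ^ i))"

text \<open>Padding with zero coefficients gives polynomials of different degrees a common range of
  summation.\<close>

lemma act_altdef:
  assumes "\<And>i. i \<ge> N \<Longrightarrow> coeff f i = 0"
  shows   "act f x = (\<Sum>i<N. to_ac (coeff f i) * x ^ (q ^ i))"
proof -
  have "act f x = (\<Sum>i<N + Suc (degree f). to_ac (coeff f i) * x ^ (q ^ i))"
    unfolding act_def by (rule sum.mono_neutral_left) (auto simp: coeff_eq_0)
  also have "\<dots> = (\<Sum>i<N. to_ac (coeff f i) * x ^ (q ^ i))"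
    by (rule sum.mono_neutral_right) (auto simp: assms)
  finally show ?thesis .
qed

lemma act_0 [simp]: "act 0 x = 0"
  by (simp add: act_def)

lemma act_1 [simp]: "act 1 x = x"
  by (simp add: act_def)

lemma act_diff: "act (f - g) x = act f x - act g x"
proof -
  define N where "N = Suc (max (degree f) (degree g))"
  have "act h x = (\<Sum>i<N. to_ac (coeff h i) * x ^ (q ^ i))" if "h \<in> {f, g, f - g}" for h
    by (rule act_altdef) (use that in \<open>auto simp: N_def coeff_eq_0\<close>)
  thus ?thesis by (simp add: sum_subtractf left_diff_distrib)
qed

lemma act_add: "act (f + g) x = act f x + act g x"
proof -
  have "act f x = act (f + g) x - act g x"
    using act_diff[of "f + g" g x] by (simp only: add_diff_cancel)
  thus ?thesis by (metis diff_add_cancel)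
qed

lemma act_smult: "act (smult c f) x = to_ac c * act f x"
proof (cases "c = 0")
  case False
  thus ?thesis
    by (simp only: act_def sum_distrib_left coeff_smult to_ac_mult mult.assoc degree_smult_eq if_False)
qed (simp only: act_0 smult_0_left to_ac_0 mult_zero_left)

lemma act_monom: "act (monom 1 n) x = x ^ (q ^ n)"
proof -
  have "act (monom 1 n) x = (\<Sum>i<Suc n. to_ac (coeff (monom 1 n) i) * x ^ (q ^ i))"
    by (rule act_altdef) auto
  thus ?thesis by simp
qed

text \<open>The coefficients lie in \<open>F_q\<close> and are fixed by the Frobenius.\<close>

lemma act_frob: "act f (x ^ q) = act f x ^ q"
proof -
  have "act f x ^ q = act f x ^ (q ^ 1)" by simp
  also have "\<dots> = act f (x ^ q)"
    using frob_to_ac[of _ 1]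
    by (simp only: act_def frob_sum power_mult_distrib) (simp add: power_mult [symmetric] mult.commute)
  finally show ?thesis by simp
qed

lemma act_pCons: "act (pCons c f) x = to_ac c * x + act f (x ^ q)"
proof -
  have "act (pCons c f) x = (\<Sum>i<Suc (Suc (degree f)). to_ac (coeff (pCons c f) i) * x ^ (q ^ i))"
    by (rule act_altdef) (auto simp: coeff_pCons coeff_eq_0 split: nat.splits)
  also have "\<dots> = to_ac c * x + act f (x ^ q)"
    by (subst sum.lessThan_Suc_shift)
       (simp only: act_def lessThan_Suc_atMost coeff_pCons_0 coeff_pCons_Suc power_0 power_one_right
         power_Suc power_mult)
  finally show ?thesis .
qed

text \<open>Induction along Horner's scheme; the step moves the Frobenius past \<open>act g\<close>
  by \<open>act_frob\<close>. This is the module law.\<close>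

lemma act_mult: "act (f * g) x = act f (act g x)"
proof (induction f)
  case (pCons c f)
  have "act (pCons c f * g) x = to_ac c * act g x + act (f * g) (x ^ q)"
    by (simp add: act_add act_smult act_pCons)
  also have "act (f * g) (x ^ q) = act f (act g x ^ q)"
    using pCons.IH by (metis act_frob)
  finally show ?case by (simp add: act_pCons)
qed simp

lemma act_zero_right [simp]: "act f 0 = 0"
  by (simp add: act_def power_0_left)

lemma act_eq_0_dvd: "act f x = 0 \<Longrightarrow> f dvd g \<Longrightarrow> act g x = 0"
  by (auto elim!: dvdE simp: act_mult mult.commute[of f])

text \<open>The kernel is the root set of the linearised polynomial \<open>g\<close> of degree
  \<open>q ^ degree f\<close>. As \<open>q\<close> vanishes in the closure, only the linear term of
  \<open>g\<close> survives differentiation, so the derivative is the nonzero constant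
  \<open>coeff f 0\<close> and all roots are simple.\<close>

lemma card_ker_act:
  assumes "coeff f 0 \<noteq> 0"
  shows   "card {x. act f x = 0} = q ^ degree f"
proof -
  define g where "g = (\<Sum>i\<le>degree f. monom (to_ac (coeff f i)) (q ^ i))"
  have g: "poly g x = act f x" for x
    by (simp add: g_def act_def poly_sum poly_monom)
  have inj: "q ^ i = q ^ j \<longleftrightarrow> i = j" for i j
    using q_ge_2 by simp
  have "degree g \<le> q ^ degree f"
    unfolding g_def
  proof (intro degree_sum_le)
    fix i assume "i \<in> {..degree f}"
    hence "q ^ i \<le> q ^ degree f"
      using q_ge_2 by (intro power_increasing) auto
    thus "degree (monom (to_ac (coeff f i)) (q ^ i)) \<le> q ^ degree f"
      using degree_monom_le order_trans by blast
  qed simp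
  moreover have "coeff g (q ^ degree f) = to_ac (lead_coeff f)"
    by (simp add: g_def coeff_sum inj sum.delta)
  moreover have f0: "f \<noteq> 0" using assms by auto
  ultimately have deg: "degree g = q ^ degree f"
    by (metis le_antisym le_degree leading_coeff_0_iff to_ac_eq_0_iff)
  have "q ^ degree f > 0" by simp
  hence "g \<noteq> 0" using deg by (metis degree_0 less_irrefl)
  have "CHAR('f) dvd q" unfolding q_eq_CARD by (rule CHAR_dvd_CARD)
  hence "of_nat q = (0 :: 'f alg_closure)"
    by (simp add: of_nat_eq_0_iff_char_dvd)
  hence qi: "of_nat (q ^ i) = (if i = 0 then 1 else 0 :: 'f alg_closure)" for i
    by (simp add: power_0_left)
  have "pderiv g = (\<Sum>i\<le>degree f. monom (of_nat (q ^ i) * to_ac (coeff f i)) (q ^ i - 1))"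
    by (simp add: g_def pderiv_sum pderiv_monom)
  also have "\<dots> = (\<Sum>i\<le>degree f. if i = 0 then [:to_ac (coeff f 0):] else 0)"
    by (intro sum.cong) (auto simp: qi monom_0 simp del: of_nat_power)
  also have "\<dots> = [:to_ac (coeff f 0):]" by simp
  finally have "card {x. poly g x = 0} = degree g"
    using \<open>g \<noteq> 0\<close> assms by (intro card_roots_eq_degree) auto
  thus ?thesis by (simp add: g deg)
qed

lemma finite_ker_act: "coeff f 0 \<noteq> 0 \<Longrightarrow> finite {x. act f x = 0}"
  by (rule card_ge_0_finite) (simp add: card_ker_act)

section \<open>Sieving the kernels by monic irreducible factors\<close>

definition monic_irr :: "'f poly set" where
  "monic_irr = {P. irreducible P \<and> lead_coeff P = 1}"

lemma monic_irr_not_dvd: "P \<in> monic_irr \<Longrightarrow> Q \<in> monic_irr \<Longrightarrow> P \<noteq> Q \<Longrightarrow> \<not> P dvd Q"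
  using monic_irreducible_dvd_eq by (auto simp: monic_irr_def)

lemma prime_elem_monic_irr: "P \<in> monic_irr \<Longrightarrow> prime_elem P"
  using field_poly_irreducible_imp_prime by (auto simp: monic_irr_def)

lemma degree_monic_irr: "P \<in> monic_irr \<Longrightarrow> degree P > 0"
  using is_unit_iff_degree[of P] irreducible_not_unit[of P]
  by (cases "P = 0") (auto simp: monic_irr_def)

text \<open>
  Induction on \<open>S\<close>: passing from \<open>S\<close> to \<open>insert Q S\<close> removes those elements that are already
  killed by \<open>h div Q\<close>, and for these the conditions at \<open>P \<in> S\<close> may be tested on \<open>h div Q\<close>
  instead of \<open>h\<close>, because \<open>P\<close> and \<open>Q\<close> are coprime.
\<close>

lemma card_ker_act_sieve:
  assumes "finite S" "S \<subseteq> monic_irr" "\<And>P. P \<in> S \<Longrightarrow> P dvd h" "coeff h 0 \<noteq> 0"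
  shows   "real (card {x. act h x = 0 \<and> (\<forall>P\<in>S. act (h div P) x \<noteq> 0)}) =
             real q ^ degree h * (\<Prod>P\<in>S. 1 - 1 / real q ^ degree P)"
  using assms
proof (induction S arbitrary: h rule: finite_induct)
  case empty
  thus ?case by (simp add: card_ker_act)
next
  case (insert Q S)
  obtain g where g: "h = Q * g" using insert.prems(2)[of Q] by (auto elim: dvdE)
  have h0: "h \<noteq> 0" using insert.prems(3) by auto
  have nz: "Q \<noteq> 0" "g \<noteq> 0" using h0 g by auto
  have g0: "coeff g 0 \<noteq> 0"
    using insert.prems(3) g by (auto simp: coeff_mult_0)
  have hQ: "h div Q = g" using g nz by simp
  have Sg: "P dvd g" if "P \<in> S" for P
  proof -
    have "P \<noteq> Q" using that insert.hyps by auto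
    moreover have PQ: "P \<in> monic_irr" "Q \<in> monic_irr" using that insert.prems(1) by auto
    ultimately have "\<not> P dvd Q" by (intro monic_irr_not_dvd)
    thus ?thesis using prime_elem_monic_irr[OF PQ(1)] insert.prems(2)[of P] that g
      by (auto simp: prime_elem_dvd_mult_iff)
  qed
  define A where "A = (\<lambda>h. {x. act h x = 0 \<and> (\<forall>P\<in>S. act (h div P) x \<noteq> 0)})"
  have key: "act (h div P) x = 0 \<longleftrightarrow> act (g div P) x = 0" if "P \<in> S" and x: "act g x = 0" for P x
  proof -
    obtain s where s: "g = P * s" using Sg[OF \<open>P \<in> S\<close>] by (elim dvdE)
    have "P \<noteq> 0" using s nz by auto
    have hs: "h div P = Q * s" "g div P = s"
      using \<open>P \<noteq> 0\<close> by (simp_all add: s g mult.left_commute[of Q])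
    have "\<not> P dvd Q"
      using \<open>P \<in> S\<close> insert.hyps insert.prems(1) by (intro monic_irr_not_dvd) auto
    moreover have "irreducible P" using \<open>P \<in> S\<close> insert.prems(1) by (auto simp: monic_irr_def)
    ultimately obtain u v where uv: "u * P + v * Q = 1"
      by (metis irreducible_poly_bezout)
    \<comment> \<open>In the Bezout identity times \<open>s\<close>, the part with \<open>u\<close>
      vanishes because \<open>P * s = g\<close> kills \<open>x\<close>.\<close>
    have "act s x = act ((u * P + v * Q) * s) x" by (simp add: uv)
    also have "\<dots> = act (u * (P * s) + v * (Q * s)) x" by (simp add: algebra_simps)
    also have "\<dots> = act v (act (Q * s) x)"
      using x s by (simp add: act_add act_mult)
    finally have "act (Q * s) x = 0 \<Longrightarrow> act s x = 0" by simp
    moreover have "act s x = 0 \<Longrightarrow> act (Q * s) x = 0" by (simp add: act_mult)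
    ultimately show ?thesis unfolding hs by blast
  qed
  have sub: "A g \<subseteq> A h"
    using key by (auto simp: A_def intro: act_eq_0_dvd simp: g)
  have "{x. act h x = 0 \<and> (\<forall>P\<in>insert Q S. act (h div P) x \<noteq> 0)} = A h - A g"
    using key by (auto simp: A_def hQ)
  moreover have "finite (A h)"
    by (rule finite_subset[OF _ finite_ker_act[OF insert.prems(3)]]) (auto simp: A_def)
  hence "real (card (A h - A g)) = real (card (A h)) - real (card (A g))"
    using sub by (simp add: card_Diff_subset finite_subset card_mono of_nat_diff)
  moreover have "real (card (A h)) = real q ^ degree h * (\<Prod>P\<in>S. 1 - 1 / real q ^ degree P)"
    unfolding A_def by (rule insert.IH) (use insert.prems in auto)
  moreover have "real (card (A g)) = real q ^ degree g * (\<Prod>P\<in>S. 1 - 1 / real q ^ degree P)"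
    unfolding A_def by (rule insert.IH) (use insert.prems Sg g0 in auto)
  moreover have "real q ^ degree h = real q ^ degree Q * real q ^ degree g"
    using g nz by (simp add: degree_mult_eq power_add)
  ultimately show ?case
    using insert.hyps by (simp add: field_simps)
qed

section \<open>The polynomial X^n - 1 and the annihilators of elements\<close>

definition xn1 :: "nat \<Rightarrow> 'f poly" where
  "xn1 n = monom 1 n - 1"

lemma act_xn1: "act (xn1 n) x = x ^ (q ^ n) - x"
  by (simp add: xn1_def act_diff act_monom)

lemma ext_field_altdef: "ext_field n = {x :: 'f alg_closure. act (xn1 n) x = 0}"
  unfolding ext_field_def act_xn1 q_eq_CARD [symmetric] by simp

lemma coeff_0_xn1: "n \<ge> 1 \<Longrightarrow> coeff (xn1 n) 0 = -1"
  by (simp add: xn1_def)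

lemma degree_xn1: "degree (xn1 n) = n"
proof (cases "n = 0")
  case False
  hence "degree (monom 1 n - 1 :: 'f poly) = degree (monom 1 n :: 'f poly)"
    unfolding diff_conv_add_uminus by (intro degree_add_eq_left) (simp add: degree_monom_eq)
  thus ?thesis by (simp add: xn1_def degree_monom_eq)
qed (simp add: xn1_def)

lemma lead_coeff_xn1: "n \<ge> 1 \<Longrightarrow> lead_coeff (xn1 n) = 1"
  unfolding degree_xn1 by (simp add: xn1_def)

lemma xn1_neq_0: "n \<ge> 1 \<Longrightarrow> xn1 n \<noteq> 0"
  using coeff_0_xn1[of n] by auto

text \<open>Such an \<open>m\<close> is the \<open>F_q\<close>-order of \<open>x\<close>: the
  minimal polynomial of the Frobenius on the cyclic module generated by \<open>x\<close>.\<close>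

definition annihilator_generator :: "'f poly \<Rightarrow> 'f alg_closure \<Rightarrow> bool" where
  "annihilator_generator m x \<longleftrightarrow> lead_coeff m = 1 \<and> (\<forall>f. act f x = 0 \<longleftrightarrow> m dvd f)"

lemma annihilator_generatorD:
  "annihilator_generator m x \<Longrightarrow> lead_coeff m = 1"
  "annihilator_generator m x \<Longrightarrow> act f x = 0 \<longleftrightarrow> m dvd f"
  by (simp_all add: annihilator_generator_def)

lemma exists_annihilator_generator:
  assumes "act f x = 0" "f \<noteq> 0"
  shows   "\<exists>m. annihilator_generator m x"
proof (rule poly_ideal_generator[of f "{f. act f x = 0}"])
  fix m :: "'f poly" assume "lead_coeff m = 1" "\<And>f. (f \<in> {f. act f x = 0}) = (m dvd f)"
  thus ?thesis by (auto simp: annihilator_generator_def)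
qed (use assms in \<open>simp_all add: act_diff act_mult\<close>)

lemma annihilator_generator_unique:
  "annihilator_generator m x \<Longrightarrow> annihilator_generator m' x \<Longrightarrow> m = m'"
  unfolding annihilator_generator_def by (metis dvd_refl monic_dvd_antisym)

text \<open>The first \<open>degree m\<close> conjugates form a basis. A linear relation among them
  is a polynomial of degree below \<open>degree m\<close> that kills \<open>x\<close>, hence zero;
  every further conjugate is reached by reducing \<open>X^i\<close> modulo \<open>m\<close>.\<close>

lemma dim_span_frobenius_orbit:
  assumes m: "annihilator_generator m x" and "m dvd xn1 n" "n \<ge> 1"
  shows   "Fq_dim (Fq_span {x ^ (q ^ i) | i. i < n}) = degree m"
proof -
  define d where "d = degree m"
  define B where "B = (\<lambda>i. x ^ (q ^ i)) ` {..<d}"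
  have m0: "m \<noteq> 0" using annihilator_generatorD[OF m] by auto
  have small: "f = 0" if "act f x = 0" "\<And>i. i \<ge> d \<Longrightarrow> coeff f i = 0" for f
  proof (rule ccontr)
    assume "f \<noteq> 0"
    have "m dvd f" using that(1) annihilator_generatorD(2)[OF m] by simp
    hence "d \<le> degree f" using \<open>f \<noteq> 0\<close> unfolding d_def by (rule dvd_imp_degree_le)
    thus False using that(2)[of "degree f"] \<open>f \<noteq> 0\<close> by simp
  qed
  have inj: "inj_on (\<lambda>i. x ^ (q ^ i)) {..<d}"
  proof (rule inj_onI)
    fix i j assume ij: "i \<in> {..<d}" "j \<in> {..<d}" "x ^ (q ^ i) = x ^ (q ^ j)"
    have "monom 1 i - monom 1 j = (0 :: 'f poly)"
      by (rule small) (use ij in \<open>simp_all add: act_diff act_monom\<close>)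
    thus "i = j" by (simp add: monom_eq_iff')
  qed
  have "d \<le> n"
    using dvd_imp_degree_le[OF assms(2) xn1_neq_0[OF assms(3)]] by (simp add: d_def degree_xn1)
  have "Fq_dim (Fq_span {x ^ (q ^ i) | i. i < n}) = Fq_dim {x ^ (q ^ i) | i. i < n}"
    by (rule Fq.dim_span)
  also have "\<dots> = d"
  proof (rule Fq.dim_unique[of B])
    show "B \<subseteq> {x ^ (q ^ i) | i. i < n}"
      using \<open>d \<le> n\<close> by (auto simp: B_def)
    show "card B = d" using inj by (simp add: B_def card_image)
    show "{x ^ (q ^ i) | i. i < n} \<subseteq> Fq_span B"
    proof safe
      fix i
      define f :: "'f poly" where "f = monom 1 i mod m"
      have f: "coeff f j = 0" if "j \<ge> d" for j
        using degree_mod_less[OF m0, of "monom 1 i"] that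
        by (auto simp: f_def d_def coeff_eq_0)
      have "act (monom 1 i) x = act (monom 1 i div m * m + f) x"
        by (simp add: f_def)
      also have "\<dots> = act f x"
        using annihilator_generatorD(2)[OF m, of m] by (simp add: act_add act_mult)
      also have "\<dots> = (\<Sum>j<d. to_ac (coeff f j) * x ^ (q ^ j))"
        using f by (rule act_altdef)
      also have "\<dots> \<in> Fq_span B"
        by (intro Fq.span_sum Fq.span_scale Fq.span_base) (auto simp: B_def)
      finally show "x ^ (q ^ i) \<in> Fq_span B" by (simp add: act_monom)
    qed
    show "Fq.independent B"
    proof (rule Fq.independent_if_scalars_zero)
      show "finite B" by (simp add: B_def)
      fix c y assume c: "(\<Sum>y\<in>B. to_ac (c y) * y) = 0" and "y \<in> B"
      then obtain i where i: "i < d" "y = x ^ (q ^ i)" by (auto simp: B_def)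
      define f where "f = Poly (map (\<lambda>i. c (x ^ (q ^ i))) [0..<d])"
      have cf: "coeff f j = (if j < d then c (x ^ (q ^ j)) else 0)" for j
        by (simp add: f_def nth_default_def)
      have "act f x = (\<Sum>j<d. to_ac (coeff f j) * x ^ (q ^ j))"
        by (rule act_altdef) (simp add: cf)
      also have "\<dots> = (\<Sum>y\<in>B. to_ac (c y) * y)"
        using inj by (simp add: B_def sum.reindex cf)
      finally have "act f x = 0" using c by simp
      hence "f = 0" by (rule small) (simp add: cf)
      thus "c y = 0" using cf[of i] i by simp
    qed
  qed
  finally show ?thesis by (simp add: d_def)
qed

lemma finite_dvd_monic_irr: "h \<noteq> 0 \<Longrightarrow> finite {P \<in> monic_irr. P dvd h}"
  by (rule finite_subset[OF _ finite_polys_degree_le[of "degree h"]]) (auto dest: dvd_imp_degree_le)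

text \<open>The annihilator is generated by \<open>h\<close> exactly if \<open>h\<close> kills
  \<open>x\<close> and no maximal proper divisor \<open>h div P\<close> does; such \<open>x\<close>
  are counted by \<open>card_ker_act_sieve\<close>.\<close>

lemma card_annihilator_generator:
  assumes "lead_coeff h = 1" "coeff h 0 \<noteq> 0"
  shows   "finite {x. annihilator_generator h x}"
    and   "real (card {x. annihilator_generator h x}) =
             real q ^ degree h * (\<Prod>P | P \<in> monic_irr \<and> P dvd h. 1 - 1 / real q ^ degree P)"
proof -
  have h0: "h \<noteq> 0" using assms by auto
  have eq: "{x. annihilator_generator h x} =
          {x. act h x = 0 \<and> (\<forall>P\<in>{P. P \<in> monic_irr \<and> P dvd h}. act (h div P) x \<noteq> 0)}"
  proof (intro equalityI subsetI; clarify)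
    fix x assume x: "annihilator_generator h x"
    have "act (h div P) x \<noteq> 0" if P: "P \<in> monic_irr" "P dvd h" for P
    proof
      assume "act (h div P) x = 0"
      hence "h dvd h div P" using annihilator_generatorD(2)[OF x] by simp
      moreover have "h = P * (h div P)" using P by simp
      moreover from this have "h div P \<noteq> 0" "P \<noteq> 0" using h0 by auto
      ultimately have "degree h \<le> degree (h div P)" "degree h = degree P + degree (h div P)"
        by (auto intro: dvd_imp_degree_le simp: degree_mult_eq [symmetric])
      thus False using degree_monic_irr[OF P(1)] by simp
    qed
    thus "act h x = 0 \<and> (\<forall>P\<in>{P. P \<in> monic_irr \<and> P dvd h}. act (h div P) x \<noteq> 0)"
      using annihilator_generatorD(2)[OF x] by simp
  next
    fix x assume x: "act h x = 0" "\<forall>P\<in>{P. P \<in> monic_irr \<and> P dvd h}. act (h div P) x \<noteq> 0"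
    obtain m where m: "annihilator_generator m x"
      using exists_annihilator_generator[OF x(1) h0] by blast
    then obtain s where s: "h = m * s" using x(1) annihilator_generatorD(2) by (metis dvdE)
    have nz: "m \<noteq> 0" "s \<noteq> 0" using s h0 by auto
    \<comment> \<open>A prime factor \<open>P\<close> of \<open>s\<close> would make
      \<open>h div P\<close> a multiple of \<open>m\<close>, so that it would kill
      \<open>x\<close>.\<close>
    have "degree s = 0"
    proof (rule ccontr)
      assume "degree s \<noteq> 0"
      then obtain P where P: "irreducible P" "lead_coeff P = 1" "P dvd s"
        using exists_monic_irreducible_dvd[of s] by blast
      obtain t where t: "s = P * t" using P(3) by (elim dvdE)
      have "P \<noteq> 0" using P(2) by auto
      hence "h div P = m * t" unfolding s t by (simp add: mult.left_commute)
      moreover have "act (m * t) x = 0" using annihilator_generatorD(2)[OF m] by simp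
      ultimately show False
        using x(2) P s t by (auto simp: monic_irr_def)
    qed
    moreover have "lead_coeff s = 1"
      using assms(1) s m by (simp add: lead_coeff_mult annihilator_generator_def)
    ultimately have "s = 1" by (metis degree_0_id one_pCons)
    thus "annihilator_generator h x" using m s by simp
  qed
  show "finite {x. annihilator_generator h x}"
    by (rule finite_subset[OF _ finite_ker_act[OF assms(2)]]) (unfold eq, blast)
  show "real (card {x. annihilator_generator h x}) =
             real q ^ degree h * (\<Prod>P | P \<in> monic_irr \<and> P dvd h. 1 - 1 / real q ^ degree P)"
    unfolding eq by (rule card_ker_act_sieve) (use finite_dvd_monic_irr[OF h0] assms in auto)
qed

section \<open>Counting k-normal elements through the divisors of X^n - 1\<close>

definition monic_divisors :: "nat \<Rightarrow> nat \<Rightarrow> 'f poly set" where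
  "monic_divisors k n = {g. lead_coeff g = 1 \<and> degree g = k \<and> g dvd xn1 n}"

lemma finite_monic_degree: "finite {g :: 'f poly. lead_coeff g = 1 \<and> degree g = k}"
  by (rule finite_subset[OF _ finite_polys_degree_le[of k]]) auto

lemma finite_monic_divisors: "finite (monic_divisors k n)"
  by (rule finite_subset[OF _ finite_monic_degree[of k]]) (auto simp: monic_divisors_def)

text \<open>The conjugates of \<open>x\<close> span a space of dimension \<open>degree m\<close>,
  where \<open>m\<close> generates the annihilator, so \<open>k\<close> is the degree of the
  cofactor \<open>g\<close> of \<open>m\<close> in \<open>X^n - 1\<close>.\<close>

lemma k_normal_iff:
  assumes "n \<ge> 1"
  shows   "k_normal n k x \<longleftrightarrow> (\<exists>g\<in>monic_divisors k n. annihilator_generator (xn1 n div g) x)"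
proof
  note nz = xn1_neq_0[OF assms]
  assume k: "k_normal n k x"
  hence x: "act (xn1 n) x = 0" by (auto simp: k_normal_def ext_field_altdef)
  then obtain m where m: "annihilator_generator m x"
    using exists_annihilator_generator nz by blast
  have "m dvd xn1 n" using annihilator_generatorD(2)[OF m] x by simp
  then obtain g where g: "xn1 n = m * g" by (elim dvdE)
  have "m \<noteq> 0" "g \<noteq> 0" using g nz by auto
  have "lead_coeff g = 1"
    using lead_coeff_xn1[OF assms] m unfolding g by (simp add: lead_coeff_mult annihilator_generator_def)
  moreover have "degree m + degree g = n"
    using degree_xn1[of n] \<open>m \<noteq> 0\<close> \<open>g \<noteq> 0\<close> unfolding g by (simp add: degree_mult_eq)
  moreover have "degree m = n - k" "k \<le> n"
    using k dim_span_frobenius_orbit[OF m \<open>m dvd xn1 n\<close> assms] by (simp_all add: k_normal_def q_eq_CARD)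
  ultimately have "g \<in> monic_divisors k n" using g by (simp add: monic_divisors_def)
  moreover have "xn1 n div g = m" using g \<open>g \<noteq> 0\<close> by simp
  ultimately show "\<exists>g\<in>monic_divisors k n. annihilator_generator (xn1 n div g) x" using m by blast
next
  assume "\<exists>g\<in>monic_divisors k n. annihilator_generator (xn1 n div g) x"
  then obtain g where g: "g \<in> monic_divisors k n" and m: "annihilator_generator (xn1 n div g) x"
    by blast
  define m where "m = xn1 n div g"
  have mg: "xn1 n = m * g" using g by (simp add: monic_divisors_def m_def)
  hence "m \<noteq> 0" "g \<noteq> 0" using xn1_neq_0[OF assms] by auto
  hence "degree m + degree g = n"
    using degree_xn1[of n] unfolding mg by (simp add: degree_mult_eq)
  moreover have "degree g = k" using g by (simp add: monic_divisors_def)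
  moreover have "m dvd xn1 n" unfolding mg by simp
  moreover from this have "act (xn1 n) x = 0"
    using annihilator_generatorD(2)[OF m] by (simp add: m_def)
  ultimately show "k_normal n k x"
    using dim_span_frobenius_orbit[OF m[folded m_def] \<open>m dvd xn1 n\<close> assms]
    by (auto simp: k_normal_def ext_field_altdef q_eq_CARD)
qed

text \<open>Annihilator generators are unique, so different \<open>g\<close> give disjoint sets,
  each of size \<open>q^(n-k)\<close> times a product over the primes \<open>P\<close> dividing
  \<open>(X^n - 1) / g\<close>, that is, with \<open>P * g\<close> dividing
  \<open>X^n - 1\<close>.\<close>

lemma k_normal_density_eq:
  assumes "n \<ge> 1"
  shows   "k_normal_density F k n =
             (\<Sum>g\<in>monic_divisors k n.
                \<Prod>P | P \<in> monic_irr \<and> P * g dvd xn1 n. 1 - 1 / real q ^ degree P) / real q ^ k"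
proof -
  note nz = xn1_neq_0[OF assms]
  define A where "A = (\<lambda>g. {x. annihilator_generator (xn1 n div g) x})"
  have g: "xn1 n = (xn1 n div g) * g" "lead_coeff (xn1 n div g) = 1" "coeff (xn1 n div g) 0 \<noteq> 0"
    "degree (xn1 n div g) + k = n" "g \<noteq> 0"
    if "g \<in> monic_divisors k n" for g
  proof -
    show eq: "xn1 n = (xn1 n div g) * g" using that by (simp add: monic_divisors_def)
    define m where "m = xn1 n div g"
    have mg: "xn1 n = m * g" using eq by (simp add: m_def)
    show "g \<noteq> 0" using mg nz by auto
    moreover have "m \<noteq> 0" using mg nz by auto
    ultimately show "degree (xn1 n div g) + k = n"
      using that degree_xn1[of n] unfolding m_def [symmetric] unfolding mg
      by (simp add: monic_divisors_def degree_mult_eq)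
    have "lead_coeff (m * g) = 1" using lead_coeff_xn1[OF assms] unfolding mg .
    hence "lead_coeff m * lead_coeff g = 1" by (simp only: lead_coeff_mult)
    moreover have "lead_coeff g = 1" using that unfolding monic_divisors_def by blast
    ultimately show "lead_coeff (xn1 n div g) = 1" unfolding m_def [symmetric] by (simp only: mult_1_right)
    show "coeff (xn1 n div g) 0 \<noteq> 0"
      using coeff_0_xn1[OF assms] unfolding m_def [symmetric] unfolding mg
      by (auto simp: coeff_mult_0)
  qed
  have disj: "A g \<inter> A g' = {}" if "g \<in> monic_divisors k n" "g' \<in> monic_divisors k n" "g \<noteq> g'" for g g'
  proof -
    have "xn1 n div g \<noteq> xn1 n div g'"
      using g(1)[OF that(1)] g(1)[OF that(2)] nz that(3) by (metis mult_cancel_left mult_zero_left)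
    thus ?thesis using annihilator_generator_unique by (auto simp: A_def)
  qed
  have "{x. k_normal n k x} = (\<Union>g\<in>monic_divisors k n. A g)"
    using k_normal_iff[OF assms] by (auto simp: A_def)
  hence "num_k_normal F n k = card (\<Union>g\<in>monic_divisors k n. A g)"
    by (simp add: num_k_normal_def)
  also have "\<dots> = (\<Sum>g\<in>monic_divisors k n. card (A g))"
    by (rule card_UN_disjoint)
       (use finite_monic_divisors card_annihilator_generator(1)[OF g(2,3)] disj in \<open>auto simp: A_def\<close>)
  finally have "k_normal_density F k n = (\<Sum>g\<in>monic_divisors k n. real (card (A g)) / real q ^ n)"
    by (simp add: k_normal_density_def q_eq_CARD sum_divide_distrib)
  also have "\<dots> = (\<Sum>g\<in>monic_divisors k n.
      (\<Prod>P | P \<in> monic_irr \<and> P * g dvd xn1 n. 1 - 1 / real q ^ degree P) / real q ^ k)"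
  proof (intro sum.cong refl)
    fix h assume h: "h \<in> monic_divisors k n"
    have "h dvd xn1 n" using h by (simp add: monic_divisors_def)
    hence "P dvd xn1 n div h \<longleftrightarrow> P * h dvd xn1 n" for P
      using g(5)[OF h] by (simp add: dvd_div_iff_mult)
    moreover have "real q ^ n = real q ^ degree (xn1 n div h) * real q ^ k"
      using g(4)[OF h] by (metis power_add)
    ultimately show "real (card (A h)) / real q ^ n =
        (\<Prod>P | P \<in> monic_irr \<and> P * h dvd xn1 n. 1 - 1 / real q ^ degree P) / real q ^ k"
      unfolding A_def card_annihilator_generator(2)[OF g(2,3)[OF h]] by simp
  qed
  finally show ?thesis by (simp add: sum_divide_distrib)
qed

section \<open>Irreducible factors of \<open>X^n - 1\<close>\<close>

text \<open>Ordinary evaluation, where \<open>X\<close> becomes the point itself instead of the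
  Frobenius as in \<open>act\<close>; it serves to study the roots of irreducible factors.\<close>

definition ev :: "'f poly \<Rightarrow> 'f alg_closure \<Rightarrow> 'f alg_closure" where
  "ev f x = poly (map_poly to_ac f) x"

lemma ev_0 [simp]: "ev 0 x = 0"
  by (simp add: ev_def)

lemma ev_pCons [simp]: "ev (pCons c f) x = to_ac c + x * ev f x"
  by (simp add: ev_def map_poly_pCons)

lemma ev_1 [simp]: "ev 1 x = 1"
  by (simp add: one_pCons)

lemma ev_add: "ev (f + g) x = ev f x + ev g x"
  by (induction f g rule: poly_induct2) (simp_all add: algebra_simps)

lemma ev_diff: "ev (f - g) x = ev f x - ev g x"
  using ev_add[of "f - g" g x] by (simp add: eq_diff_eq)

lemma ev_smult: "ev (smult c f) x = to_ac c * ev f x"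
  by (induction f) (simp_all add: algebra_simps)

lemma ev_mult: "ev (f * g) x = ev f x * ev g x"
  by (induction f) (simp_all add: ev_add ev_smult algebra_simps)

lemma ev_monom: "ev (monom 1 n) x = x ^ n"
  by (simp add: ev_def map_poly_monom poly_monom)

lemma ev_frob: "ev f (x ^ (q ^ i)) = ev f x ^ (q ^ i)"
  by (induction f) (simp_all add: frob_add frob_to_ac power_mult_distrib power_0_left)

lemma ev_xn1: "ev (xn1 n) x = x ^ n - 1"
  by (simp add: xn1_def ev_diff ev_monom)

text \<open>\<open>P\<close> is the minimal polynomial of its root \<open>x\<close>: if
  \<open>P\<close> did not divide \<open>f\<close>, a Bezout identity evaluated at \<open>x\<close>
  would read 0 = 1.\<close>

lemma monic_irr_dvd_iff:
  assumes "P \<in> monic_irr" "ev P x = 0"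
  shows   "P dvd f \<longleftrightarrow> ev f x = 0"
proof
  assume f: "ev f x = 0"
  show "P dvd f"
  proof (rule ccontr)
    assume "\<not> P dvd f"
    then obtain u v where "u * P + v * f = 1"
      using assms(1) irreducible_poly_bezout[of P f] by (auto simp: monic_irr_def)
    hence "ev (u * P + v * f) x = 1" by simp
    thus False using assms(2) f by (simp add: ev_add ev_mult)
  qed
qed (use assms(2) in \<open>auto simp: ev_mult elim!: dvdE\<close>)

lemma card_ext_field': "n \<ge> 1 \<Longrightarrow> card {x :: 'f alg_closure. x ^ (q ^ n) = x} = q ^ n"
  using card_ext_field[of n, where ?'f = 'f] by (simp add: ext_field_def q_eq_CARD)

text \<open>
  If \<open>x\<close> lies in \<open>F_(q^s)\<close>, then so do the \<open>q^deg P\<close> distinct values at \<open>x\<close> of the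
  polynomials of degree less than \<open>deg P\<close>.
\<close>

lemma degree_le_of_frobenius_fixed:
  assumes P: "P \<in> monic_irr" "ev P x = 0" and "x ^ (q ^ s) = x" "s \<ge> 1"
  shows   "degree P \<le> s"
proof -
  have fixed: "ev f x ^ (q ^ s) = ev f x" for f
    using ev_frob[of f x s] by (simp only: assms(3))
  define L where "L = {xs :: 'f list. set xs \<subseteq> UNIV \<and> length xs = degree P}"
  have inj: "inj_on (\<lambda>xs. ev (Poly xs) x) L"
  proof (rule inj_onI)
    fix xs ys assume L: "xs \<in> L" "ys \<in> L" and eq: "ev (Poly xs) x = ev (Poly ys) x"
    \<comment> \<open>Equal values at \<open>x\<close> force the difference to be a multiple of
      \<open>P\<close>, while its degree is below \<open>degree P\<close>.\<close>
    have "coeff (Poly xs - Poly ys) i = 0" if "i \<ge> degree P" for i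
      using L that by (simp add: L_def nth_default_def)
    hence "Poly xs - Poly ys = 0 \<or> degree (Poly xs - Poly ys) < degree P"
      using degree_monic_irr[OF P(1)] by (metis leading_coeff_0_iff not_le)
    moreover have "P dvd Poly xs - Poly ys"
      using eq by (simp add: monic_irr_dvd_iff[OF P] ev_diff)
    ultimately have "Poly xs = Poly ys"
      using dvd_imp_degree_le[of P "Poly xs - Poly ys"] by fastforce
    hence "nth_default 0 xs i = nth_default 0 ys i" for i by (metis coeff_Poly_eq)
    thus "xs = ys"
      using L by (intro nth_equalityI) (auto simp: L_def nth_default_def split: if_splits, metis)
  qed
  have sub: "(\<lambda>xs. ev (Poly xs) x) ` L \<subseteq> {x. x ^ (q ^ s) = x}"
    using fixed by blast
  have "finite {x :: 'f alg_closure. x ^ (q ^ s) = x}"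
    by (rule card_ge_0_finite) (simp only: card_ext_field'[OF assms(4)], simp)
  from card_inj_on_le[OF inj sub this] have "card L \<le> q ^ s"
    by (simp only: card_ext_field'[OF assms(4)])
  moreover have "card L = q ^ degree P"
    unfolding L_def q_eq_CARD by (rule card_lists_length_eq) simp
  ultimately have "q ^ degree P \<le> q ^ s" by simp
  thus ?thesis using q_ge_2 by simp
qed

text \<open>The conjugates \<open>x ^ (q ^ i)\<close> with \<open>i < degree P\<close> are distinct
  by \<open>degree_le_of_frobenius_fixed\<close>, hence they are all the roots. The next conjugate
  is a root too, so it equals one of them; cancelling the common Frobenius power shows that this one
  is \<open>x\<close>.\<close>

lemma roots_monic_irr:
  assumes P: "P \<in> monic_irr"
  shows   "card {x. ev P x = 0} = degree P" "ev P x = 0 \<Longrightarrow> x ^ (q ^ degree P) = x"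
proof -
  define j where "j = degree P"
  have deg: "degree (map_poly to_ac P) = j" by (simp add: j_def degree_map_poly)
  have j: "j > 0" using degree_monic_irr[OF P] by (simp add: j_def)
  have nz: "map_poly to_ac P \<noteq> 0" using deg j by auto
  have fin: "finite {x. ev P x = 0}" and le: "card {x. ev P x = 0} \<le> j"
    using poly_roots_finite[OF nz] card_poly_roots_bound[OF nz] by (simp_all add: ev_def deg)
  have orbit: "card ((\<lambda>i. x ^ (q ^ i)) ` {..<j}) = j" "(\<lambda>i. x ^ (q ^ i)) ` {..<j} \<subseteq> {x. ev P x = 0}"
    if x: "ev P x = 0" for x
  proof -
    have "x ^ (q ^ i) \<noteq> x ^ (q ^ l)" if "i < l" "l < j" for i l
    proof
      assume eq: "x ^ (q ^ i) = x ^ (q ^ l)"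
      have "q ^ l = q ^ (l - i) * q ^ i" using that by (simp flip: power_add)
      hence "(x ^ (q ^ (l - i))) ^ (q ^ i) = x ^ (q ^ i)" using eq by (simp add: power_mult)
      hence "x ^ (q ^ (l - i)) = x" by (rule frob_inj)
      from degree_le_of_frobenius_fixed[OF P x this] that have "j \<le> l - i" by (simp add: j_def)
      thus False using that by linarith
    qed
    hence "inj_on (\<lambda>i. x ^ (q ^ i)) {..<j}"
      by (intro linorder_inj_onI) auto
    thus "card ((\<lambda>i. x ^ (q ^ i)) ` {..<j}) = j" by (simp add: card_image)
    show "(\<lambda>i. x ^ (q ^ i)) ` {..<j} \<subseteq> {x. ev P x = 0}"
      using x by (auto simp: ev_frob power_0_left)
  qed
  obtain x0 where x0: "ev P x0 = 0"
    using alg_closed_imp_poly_has_root[of "map_poly to_ac P"] deg j by (auto simp: ev_def)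
  have "j \<le> card {x. ev P x = 0}"
    using card_mono[OF fin orbit(2)[OF x0]] orbit(1)[OF x0] by simp
  thus card: "card {x. ev P x = 0} = degree P" using le by (simp add: j_def)
  show "x ^ (q ^ degree P) = x" if x: "ev P x = 0"
  proof -
    have "(\<lambda>i. x ^ (q ^ i)) ` {..<j} = {x. ev P x = 0}"
      using card orbit[OF x] fin by (intro card_subset_eq) (simp_all add: j_def)
    moreover have "ev P (x ^ (q ^ j)) = 0" using x by (simp add: ev_frob power_0_left)
    ultimately obtain i where i: "i < j" "x ^ (q ^ j) = x ^ (q ^ i)" by blast
    have "q ^ j = q ^ (j - i) * q ^ i" using i by (simp flip: power_add)
    hence "(x ^ (q ^ (j - i))) ^ (q ^ i) = x ^ (q ^ i)" using i by (simp add: power_mult)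
    hence fixed: "x ^ (q ^ (j - i)) = x" by (rule frob_inj)
    hence "j \<le> j - i"
      using degree_le_of_frobenius_fixed[OF P x fixed] i by (simp add: j_def)
    hence "i = 0" using j by simp
    thus ?thesis using i by (simp add: j_def)
  qed
qed

text \<open>Different primes have disjoint sets of \<open>j\<close> roots each. All these roots
  satisfy \<open>x^n = 1\<close> and \<open>x^(q^j - 1) = 1\<close>, so they are roots of unity for
  the gcd of the exponents.\<close>

lemma card_monic_irr_dvd_xn1_le:
  assumes "n \<ge> 1" "j \<ge> 1"
  shows   "j * card {P \<in> monic_irr. degree P = j \<and> P dvd xn1 n} \<le> gcd n (q ^ j - 1)"
proof -
  define S where "S = {P \<in> monic_irr. degree P = j \<and> P dvd xn1 n}"
  define R where "R = (\<lambda>P. {x. ev P x = 0})"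
  have S: "finite S"
    using finite_subset[OF _ finite_dvd_monic_irr[OF xn1_neq_0[OF assms(1)]], of S]
    by (auto simp: S_def)
  have cR: "card (R P) = j" if "P \<in> S" for P
    using roots_monic_irr(1)[of P] that by (auto simp: R_def S_def)
  have fR: "finite (R P)" if "P \<in> S" for P
    by (rule card_ge_0_finite) (use cR[OF that] assms(2) in simp)
  have disj: "R P \<inter> R Q = {}" if "P \<in> S" "Q \<in> S" "P \<noteq> Q" for P Q
  proof (rule ccontr)
    assume "R P \<inter> R Q \<noteq> {}"
    then obtain x where x: "ev P x = 0" "ev Q x = 0" by (auto simp: R_def)
    have "P dvd Q" using that x monic_irr_dvd_iff[of P x Q] by (auto simp: S_def)
    thus False using that monic_irr_not_dvd[of P Q] by (auto simp: S_def)
  qed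
  have "q ^ j > 1" using q_ge_2 assms(2) by (intro one_less_power) auto
  have sub: "(\<Union>P\<in>S. R P) \<subseteq> {x. x ^ gcd n (q ^ j - 1) = 1}"
  proof safe
    fix P x assume "P \<in> S" "x \<in> R P"
    hence P: "P \<in> monic_irr" "degree P = j" "P dvd xn1 n" "ev P x = 0"
      by (auto simp: S_def R_def)
    have "ev (xn1 n) x = 0" using P monic_irr_dvd_iff by blast
    hence xn: "x ^ n = 1" by (simp add: ev_xn1)
    hence "x \<noteq> 0" using assms(1) by (auto simp: power_0_left)
    moreover have "x ^ (q ^ j) = x" using roots_monic_irr(2)[OF P(1,4)] P(2) by simp
    moreover have "x ^ (q ^ j) = x ^ (q ^ j - 1) * x"
      using \<open>q ^ j > 1\<close> by (metis Suc_diff_1 less_trans power_Suc2 zero_less_one)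
    ultimately have "x ^ (q ^ j - 1) = 1" by simp
    thus "x ^ gcd n (q ^ j - 1) = 1" using xn by (intro power_gcd_eq_1)
  qed
  have g: "gcd n (q ^ j - 1) > 0" using assms(1) by simp
  have "j * card S = (\<Sum>P\<in>S. card (R P))" using cR by simp
  also have "\<dots> = card (\<Union>P\<in>S. R P)"
    using S fR disj by (intro card_UN_disjoint [symmetric]) auto
  also have "\<dots> \<le> card {x :: 'f alg_closure. x ^ gcd n (q ^ j - 1) = 1}"
    by (rule card_mono[OF card_roots_of_unity_le(1)[OF g] sub])
  also have "\<dots> \<le> gcd n (q ^ j - 1)" by (rule card_roots_of_unity_le(2)[OF g])
  finally show ?thesis by (simp add: S_def)
qed

section \<open>Total weight of the irreducible factors of large degree\<close>

definition tail_weight :: "nat \<Rightarrow> nat \<Rightarrow> real" where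
  "tail_weight D n = (\<Sum>P | P \<in> monic_irr \<and> P dvd xn1 n \<and> degree P > D. 1 / real q ^ degree P)"

text \<open>The primes are grouped by degree \<open>j\<close>. The sum runs to \<open>N\<close>
  instead of \<open>n\<close> so that its range is common to all \<open>n \<le> N\<close> when
  averages are taken.\<close>

lemma tail_weight_le:
  assumes "n \<ge> 1" "n \<le> N"
  shows   "tail_weight D n \<le> (\<Sum>j\<in>{D<..N}. real (gcd n (q ^ j - 1)) / (real j * real q ^ j))"
proof -
  define S where "S = {P \<in> monic_irr. P dvd xn1 n \<and> degree P > D}"
  have S: "finite S"
    using finite_subset[OF _ finite_dvd_monic_irr[OF xn1_neq_0[OF assms(1)]], of S]
    by (auto simp: S_def)
  have "degree ` S \<subseteq> {D<..N}"
    using dvd_imp_degree_le[OF _ xn1_neq_0[OF assms(1)]] assms(2)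
    by (fastforce simp: S_def degree_xn1)
  hence "tail_weight D n = (\<Sum>j\<in>{D<..N}. \<Sum>P\<in>{P \<in> S. degree P = j}. 1 / real q ^ degree P)"
    unfolding tail_weight_def using S by (subst sum.group) (simp_all add: S_def)
  also have "\<dots> \<le> (\<Sum>j\<in>{D<..N}. real (gcd n (q ^ j - 1)) / (real j * real q ^ j))"
  proof (rule sum_mono)
    fix j assume j: "j \<in> {D<..N}"
    have "{P \<in> S. degree P = j} = {P \<in> monic_irr. degree P = j \<and> P dvd xn1 n}"
      using j by (auto simp: S_def)
    hence "j * card {P \<in> S. degree P = j} \<le> gcd n (q ^ j - 1)"
      using card_monic_irr_dvd_xn1_le[of n j] assms(1) j by simp
    hence "real j * real (card {P \<in> S. degree P = j}) \<le> real (gcd n (q ^ j - 1))"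
      by (metis of_nat_le_iff of_nat_mult)
    hence "real (card {P \<in> S. degree P = j}) / real q ^ j \<le> real (gcd n (q ^ j - 1)) / (real j * real q ^ j)"
      using j by (simp add: field_simps)
    moreover have "(\<Sum>P\<in>{P \<in> S. degree P = j}. 1 / real q ^ degree P) =
        real (card {P \<in> S. degree P = j}) / real q ^ j"
      by simp
    ultimately show "(\<Sum>P\<in>{P \<in> S. degree P = j}. 1 / real q ^ degree P) \<le>
        real (gcd n (q ^ j - 1)) / (real j * real q ^ j)"
      by linarith
  qed
  finally show ?thesis .
qed

text \<open>Exchanging the sums over \<open>n\<close> and \<open>j\<close> lets
  \<open>sum_gcd_le\<close> replace each gcd by its mean value, for every length
  \<open>N\<close>.\<close>

lemma sum_tail_weight_le:
  "(\<Sum>n=1..N. tail_weight D n) \<le>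
     real N * (\<Sum>j\<in>{D<..N}. gcd_mean (q ^ j - 1) / (real j * real q ^ j))"
proof -
  have "(\<Sum>n=1..N. tail_weight D n) \<le>
          (\<Sum>n=1..N. \<Sum>j\<in>{D<..N}. real (gcd n (q ^ j - 1)) / (real j * real q ^ j))"
    by (intro sum_mono tail_weight_le) auto
  also have "\<dots> = (\<Sum>j\<in>{D<..N}. (\<Sum>n=1..N. real (gcd n (q ^ j - 1))) / (real j * real q ^ j))"
    by (subst sum.swap) (simp only: sum_divide_distrib)
  also have "\<dots> \<le> (\<Sum>j\<in>{D<..N}. (real N * gcd_mean (q ^ j - 1)) / (real j * real q ^ j))"
  proof (intro sum_mono divide_right_mono sum_gcd_le)
    fix j assume "j \<in> {D<..N}"
    hence "q ^ j > 1" using q_ge_2 by (intro one_less_power) auto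
    thus "q ^ j - 1 > 0" by simp
  qed simp
  also have "\<dots> = real N * (\<Sum>j\<in>{D<..N}. gcd_mean (q ^ j - 1) / (real j * real q ^ j))"
    by (simp add: sum_distrib_left)
  finally show ?thesis .
qed

section \<open>Existence and estimates of the mean densities\<close>

lemma weight_bounds:
  assumes "P \<in> monic_irr"
  shows   "0 < 1 / real q ^ degree P" "1 / real q ^ degree P \<le> 1 / 2"
proof -
  have "q ^ 1 \<le> q ^ degree P"
    using degree_monic_irr[OF assms] q_ge_2 by (intro power_increasing) auto
  hence "real 2 \<le> real (q ^ degree P)" using q_ge_2 by (intro of_nat_mono) simp
  thus "1 / real q ^ degree P \<le> 1 / 2" by (simp add: field_simps)
qed simp

text \<open>The formula of \<open>k_normal_density_eq\<close> restricted to primes of degree at most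
  \<open>D\<close>, so that finitely many divisibility conditions, independent of \<open>n\<close>,
  determine it.\<close>

definition density_trunc :: "nat \<Rightarrow> nat \<Rightarrow> nat \<Rightarrow> real" where
  "density_trunc D k n =
     (\<Sum>g\<in>monic_divisors k n.
        \<Prod>P | P \<in> monic_irr \<and> P * g dvd xn1 n \<and> degree P \<le> D. 1 - 1 / real q ^ degree P) / real q ^ k"

lemma finite_prime_factors:
  assumes "n \<ge> 1"
  shows   "finite {P. P \<in> monic_irr \<and> P dvd xn1 n}" "finite {P. P \<in> monic_irr \<and> P * g dvd xn1 n}"
  using finite_dvd_monic_irr[OF xn1_neq_0[OF assms]]
  by (auto elim!: rev_finite_subset dest: dvd_mult_left)

text \<open>For each \<open>g\<close>, the product over the primes of degree above \<open>D\<close>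
  lies between \<open>1 - tail_weight D n\<close> and 1 by the Weierstrass inequality, and the
  remaining factors are in the unit interval. The number of \<open>g\<close> is bounded
  independently of \<open>n\<close>.\<close>

lemma density_trunc_error:
  assumes "n \<ge> 1"
  shows   "\<bar>k_normal_density F k n - density_trunc D k n\<bar> \<le>
             real (card {g :: 'f poly. lead_coeff g = 1 \<and> degree g = k}) * tail_weight D n"
proof -
  define u where "u = (\<lambda>P :: 'f poly. 1 / real q ^ degree P)"
  have u: "0 < u P \<and> u P \<le> 1 / 2" if "P \<in> monic_irr" for P
    using weight_bounds[OF that] by (simp add: u_def)
  have tail: "tail_weight D n \<ge> 0" unfolding tail_weight_def by (intro sum_nonneg) simp
  have *: "\<bar>(\<Prod>P | P \<in> monic_irr \<and> P * g dvd xn1 n. 1 - u P) -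
             (\<Prod>P | P \<in> monic_irr \<and> P * g dvd xn1 n \<and> degree P \<le> D. 1 - u P)\<bar> \<le> tail_weight D n" for g
  proof -
    define A where "A = {P. P \<in> monic_irr \<and> P * g dvd xn1 n \<and> degree P \<le> D}"
    define B where "B = {P. P \<in> monic_irr \<and> P * g dvd xn1 n \<and> degree P > D}"
    have fin: "finite {P. P \<in> monic_irr \<and> P * g dvd xn1 n}" by (rule finite_prime_factors[OF assms])
    have AB: "{P. P \<in> monic_irr \<and> P * g dvd xn1 n} = A \<union> B" "A \<inter> B = {}"
      by (auto simp: A_def B_def)
    hence finAB: "finite A" "finite B" using fin by simp_all
    have A: "0 \<le> (\<Prod>P\<in>A. 1 - u P)" "(\<Prod>P\<in>A. 1 - u P) \<le> 1"
      using u by (force intro!: prod_nonneg prod_le_1 simp: A_def)+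
    have "(\<Prod>P\<in>B. 1 - u P) \<le> 1"
      using u by (force intro!: prod_le_1 simp: B_def)
    have "1 - (\<Sum>P\<in>B. u P) \<le> (\<Prod>P\<in>B. 1 - u P)"
      using u by (intro Weierstrass_prod_ineq) (force simp: B_def)
    moreover have "(\<Sum>P\<in>B. u P) \<le> tail_weight D n"
      unfolding tail_weight_def u_def
      using finite_prime_factors(1)[OF assms]
      by (intro sum_mono2) (auto simp: B_def elim!: rev_finite_subset dest: dvd_mult_left)
    ultimately have "\<bar>(\<Prod>P\<in>B. 1 - u P) - 1\<bar> \<le> tail_weight D n"
      using \<open>(\<Prod>P\<in>B. 1 - u P) \<le> 1\<close> by linarith
    hence "(\<Prod>P\<in>A. 1 - u P) * \<bar>(\<Prod>P\<in>B. 1 - u P) - 1\<bar> \<le> 1 * tail_weight D n"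
      using A by (intro mult_mono) auto
    moreover have "(\<Prod>P | P \<in> monic_irr \<and> P * g dvd xn1 n. 1 - u P) = (\<Prod>P\<in>A. 1 - u P) * (\<Prod>P\<in>B. 1 - u P)"
      unfolding AB(1) by (rule prod.union_disjoint[OF finAB AB(2)])
    moreover have "\<bar>(\<Prod>P\<in>A. 1 - u P) * (\<Prod>P\<in>B. 1 - u P) - (\<Prod>P\<in>A. 1 - u P)\<bar> =
        (\<Prod>P\<in>A. 1 - u P) * \<bar>(\<Prod>P\<in>B. 1 - u P) - 1\<bar>"
      using A(1) abs_mult[of "\<Prod>P\<in>A. 1 - u P" "(\<Prod>P\<in>B. 1 - u P) - 1"]
      by (simp add: right_diff_distrib)
    ultimately show ?thesis by (simp add: A_def)
  qed
  have "\<bar>k_normal_density F k n - density_trunc D k n\<bar> =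
          \<bar>\<Sum>g\<in>monic_divisors k n. (\<Prod>P | P \<in> monic_irr \<and> P * g dvd xn1 n. 1 - u P) -
             (\<Prod>P | P \<in> monic_irr \<and> P * g dvd xn1 n \<and> degree P \<le> D. 1 - u P)\<bar> / real q ^ k"
    unfolding k_normal_density_eq[OF assms] density_trunc_def u_def sum_subtractf
    by (simp add: diff_divide_distrib [symmetric] abs_divide)
  \<comment> \<open>The factor \<open>q^(-k)\<close> is at most 1 and is dropped.\<close>
  also have "\<dots> \<le> \<bar>\<Sum>g\<in>monic_divisors k n. (\<Prod>P | P \<in> monic_irr \<and> P * g dvd xn1 n. 1 - u P) -
             (\<Prod>P | P \<in> monic_irr \<and> P * g dvd xn1 n \<and> degree P \<le> D. 1 - u P)\<bar> / 1"
    by (intro divide_left_mono) (auto simp: Suc_leI)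
  also have "\<dots> \<le> real (card (monic_divisors k n)) * tail_weight D n"
    unfolding div_by_1 by (intro order_trans[OF sum_abs] sum_bounded_above *)
  also have "\<dots> \<le> real (card {g :: 'f poly. lead_coeff g = 1 \<and> degree g = k}) * tail_weight D n"
    by (intro mult_right_mono of_nat_mono card_mono finite_monic_degree tail)
       (auto simp: monic_divisors_def)
  finally show ?thesis .
qed

text \<open>By \<open>X^(n+T) - 1 = X^n (X^T - 1) + (X^n - 1)\<close>, any \<open>S \<ge> 1\<close>
  with \<open>h\<close> dividing \<open>X^S - 1\<close> is a period for \<open>h\<close>; if there
  is none, the condition fails for all \<open>n \<ge> 1\<close> and 1 is a period. Periods of
  several \<open>h\<close> are multiplied. At \<open>n = 0\<close> the polynomial is zero, whence
  the restriction on \<open>n\<close>.\<close>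

lemma dvd_xn1_periodic:
  assumes "finite H"
  shows   "\<exists>T\<ge>1. \<forall>h\<in>H. \<forall>n\<ge>1. h dvd xn1 (n + T) \<longleftrightarrow> h dvd xn1 n"
proof -
  have add: "xn1 (n + T) = monom 1 n * xn1 T + xn1 n" for n T
    by (simp add: xn1_def mult_monom algebra_simps)
  have mult: "h dvd xn1 (n + T * k) \<longleftrightarrow> h dvd xn1 n"
    if "\<And>n. n \<ge> 1 \<Longrightarrow> h dvd xn1 (n + T) \<longleftrightarrow> h dvd xn1 n" "n \<ge> 1" for h T k n
  proof (induction k)
    case (Suc k)
    have "n + T * Suc k = (n + T * k) + T" by simp
    thus ?case using that(1)[of "n + T * k"] that(2) Suc.IH by (metis le_add1 le_trans)
  qed simp
  show ?thesis
    using assms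
  proof (induction H rule: finite_induct)
    case (insert h H)
    obtain T where T: "T \<ge> 1" "\<And>h n. h \<in> H \<Longrightarrow> n \<ge> 1 \<Longrightarrow> h dvd xn1 (n + T) \<longleftrightarrow> h dvd xn1 n"
      using insert.IH by blast
    obtain S where S: "S \<ge> 1" "\<And>n. n \<ge> 1 \<Longrightarrow> h dvd xn1 (n + S) \<longleftrightarrow> h dvd xn1 n"
    proof (cases "\<exists>S\<ge>1. h dvd xn1 S")
      case True
      then obtain S where "S \<ge> 1" "h dvd xn1 S" by blast
      thus ?thesis using that[of S] by (simp add: add dvd_add_right_iff)
    next
      case False
      thus ?thesis using that[of 1] by simp
    qed
    have "h' dvd xn1 (n + T * S) \<longleftrightarrow> h' dvd xn1 n" if "h' \<in> insert h H" "n \<ge> 1" for h' n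
    proof (cases "h' = h")
      case True
      thus ?thesis using mult[OF S(2) that(2), of T] by (simp add: mult.commute)
    next
      case False
      thus ?thesis using mult[OF T(2)[of h'] that(2)] that(1) by blast
    qed
    moreover have "T * S \<ge> 1" using T(1) S(1) by simp
    ultimately show ?case by blast
  qed auto
qed

lemma convergent_average_density_trunc: "convergent (average (density_trunc D k))"
proof -
  define G where "G = {g :: 'f poly. lead_coeff g = 1 \<and> degree g = k}"
  \<comment> \<open>These are all the polynomials whose divisibility into \<open>X^n - 1\<close> is
    tested in \<open>density_trunc D k n\<close>.\<close>
  define H where "H = G \<union> (\<lambda>(P, g). P * g) ` ({P \<in> monic_irr. degree P \<le> D} \<times> G)"
  have "finite {P \<in> monic_irr. degree P \<le> D}"
    by (rule finite_subset[OF _ finite_polys_degree_le[of D]]) auto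
  hence "finite H"
    unfolding H_def G_def by (intro finite_UnI finite_imageI finite_cartesian_product finite_monic_degree)
  from dvd_xn1_periodic[OF this]
  obtain T where T: "T \<ge> 1" "\<And>h n. h \<in> H \<Longrightarrow> n \<ge> 1 \<Longrightarrow> h dvd xn1 (n + T) \<longleftrightarrow> h dvd xn1 n"
    by blast
  show ?thesis
  proof (rule convergent_average_periodic[OF T(1)])
    fix n :: nat assume n: "n \<ge> 1"
    have "monic_divisors k (n + T) = monic_divisors k n"
      using T(2)[OF _ n] by (auto simp: monic_divisors_def H_def G_def)
    moreover have "{P. P \<in> monic_irr \<and> P * g dvd xn1 (n + T) \<and> degree P \<le> D} =
        {P. P \<in> monic_irr \<and> P * g dvd xn1 n \<and> degree P \<le> D}" if "g \<in> monic_divisors k n" for g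
    proof -
      have "P * g \<in> H" if "P \<in> monic_irr" "degree P \<le> D" for P
        using that \<open>g \<in> monic_divisors k n\<close> by (auto simp: monic_divisors_def H_def G_def)
      thus ?thesis using T(2)[OF _ n] by blast
    qed
    ultimately show "density_trunc D k (n + T) = density_trunc D k n"
      by (simp add: density_trunc_def)
  qed
qed

lemma gcd_mean_q_le:
  assumes "j \<ge> 1"
  shows   "gcd_mean (q ^ j - 1) \<le> 9 / 8 * sqrt (real q) ^ j"
proof -
  have "q ^ j > 1" using q_ge_2 assms by (intro one_less_power) auto
  hence "(gcd_mean (q ^ j - 1))\<^sup>2 \<le> 9 / 8 * real (q ^ j - 1)"
    by (intro gcd_mean_sq_le) simp
  also have "\<dots> \<le> 9 / 8 * real (q ^ j)"
    by simp
  \<comment> \<open>Enlarging the constant to a square keeps it rational after taking roots.\<close>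
  also have "\<dots> \<le> (9 / 8)\<^sup>2 * real (q ^ j)"
    by (intro mult_right_mono) (simp_all add: power2_eq_square)
  also have "\<dots> = (9 / 8 * sqrt (real q) ^ j)\<^sup>2"
    by (simp only: power_mult_distrib power_mult [symmetric] mult.commute[of j])
       (simp add: power_mult)
  finally show ?thesis by (rule power2_le_imp_le) simp
qed

lemma inverse_sqrt_q: "0 < 1 / sqrt (real q)" "1 / sqrt (real q) < 1"
  using q_ge_2 by auto

lemma average_tail_term_le:
  assumes "j \<ge> 1"
  shows   "gcd_mean (q ^ j - 1) / (real j * real q ^ j) \<le> 9 / 8 * (1 / sqrt (real q)) ^ j / real j"
proof -
  have eq: "real q ^ j = sqrt (real q) ^ j * sqrt (real q) ^ j"
    by (simp add: power_mult_distrib [symmetric])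
  have "gcd_mean (q ^ j - 1) / (real j * real q ^ j) \<le>
          9 / 8 * sqrt (real q) ^ j / (real j * real q ^ j)"
    by (intro divide_right_mono gcd_mean_q_le assms) simp
  also have "\<dots> = 9 / 8 * (1 / sqrt (real q)) ^ j / real j"
    unfolding eq by (simp add: power_divide)
  finally show ?thesis .
qed

text \<open>This is \<open>9/8\<close> times the geometric tail of the powers of
  \<open>1 / sqrt q\<close> with exponent above \<open>D\<close>.\<close>

definition tail_bound :: "nat \<Rightarrow> real" where
  "tail_bound D = 9 / 8 * ((1 / sqrt (real q)) ^ Suc D / (1 - 1 / sqrt (real q)))"

text \<open>Every \<open>1 / j\<close> is at most \<open>1 / (D + 1)\<close>. This factor is kept
  for the explicit estimate, which takes \<open>D = 3\<close>.\<close>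

lemma average_tail_sum_le:
  "(\<Sum>j\<in>{D<..N}. gcd_mean (q ^ j - 1) / (real j * real q ^ j)) \<le> tail_bound D / real (Suc D)"
proof -
  have "(\<Sum>j\<in>{D<..N}. gcd_mean (q ^ j - 1) / (real j * real q ^ j)) \<le>
          (\<Sum>j\<in>{D<..N}. 9 / 8 * (1 / sqrt (real q)) ^ j / real (Suc D))"
  proof (rule sum_mono)
    fix j assume j: "j \<in> {D<..N}"
    have "gcd_mean (q ^ j - 1) / (real j * real q ^ j) \<le> 9 / 8 * (1 / sqrt (real q)) ^ j / real j"
      using j by (intro average_tail_term_le) simp
    also have "\<dots> \<le> 9 / 8 * (1 / sqrt (real q)) ^ j / real (Suc D)"
      using j by (intro divide_left_mono) auto
    finally show "gcd_mean (q ^ j - 1) / (real j * real q ^ j) \<le>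
        9 / 8 * (1 / sqrt (real q)) ^ j / real (Suc D)" .
  qed
  also have "\<dots> = 9 / 8 * (\<Sum>j\<in>{D<..N}. (1 / sqrt (real q)) ^ j) / real (Suc D)"
    by (simp only: sum_distrib_left sum_divide_distrib)
  also have "\<dots> \<le> tail_bound D / real (Suc D)"
    unfolding tail_bound_def using inverse_sqrt_q
    by (intro divide_right_mono mult_left_mono sum_power_greaterThanAtMost_le) auto
  finally show ?thesis .
qed

lemma tail_bound_nonneg: "tail_bound D \<ge> 0"
  unfolding tail_bound_def using inverse_sqrt_q by simp

lemma average_tail_weight_le: "average (tail_weight D) N \<le> tail_bound D"
proof (cases "N = 0")
  case False
  have "average (tail_weight D) N \<le> (\<Sum>j\<in>{D<..N}. gcd_mean (q ^ j - 1) / (real j * real q ^ j))"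
    using sum_tail_weight_le[of D N] False by (simp add: average_def field_simps)
  also have "\<dots> \<le> tail_bound D / real (Suc D)" by (rule average_tail_sum_le)
  also have "\<dots> \<le> tail_bound D / 1"
    using tail_bound_nonneg by (intro divide_left_mono) auto
  finally show ?thesis by simp
qed (simp add: average_def tail_bound_nonneg)

lemma tail_bound_tendsto_0: "tail_bound \<longlonglongrightarrow> 0"
proof -
  have "(\<lambda>D. (1 / sqrt (real q)) ^ Suc D) \<longlonglongrightarrow> 0"
    using inverse_sqrt_q by (intro LIMSEQ_Suc LIMSEQ_power_zero) simp
  hence "(\<lambda>D. 9 / 8 * ((1 / sqrt (real q)) ^ Suc D / (1 - 1 / sqrt (real q)))) \<longlonglongrightarrow>
           9 / 8 * (0 / (1 - 1 / sqrt (real q)))"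
    using inverse_sqrt_q by (intro tendsto_intros) auto
  thus ?thesis unfolding tail_bound_def [abs_def] by simp
qed

text \<open>The averages are within \<open>C * tail_bound D\<close> of convergent ones, uniformly in
  \<open>N\<close>, so they are Cauchy. Once convergence is known, the \<open>Lim\<close> defining
  the mean is their limit.\<close>

lemma average_density_tendsto: "average (k_normal_density F k) \<longlonglongrightarrow> mean_k_normal_density F k"
proof -
  define C where "C = real (card {g :: 'f poly. lead_coeff g = 1 \<and> degree g = k})"
  have "convergent (average (k_normal_density F k))"
  proof (rule convergent_uniform_approx)
    fix \<epsilon> :: real assume "\<epsilon> > 0"
    have "(\<lambda>D. C * tail_bound D) \<longlonglongrightarrow> C * 0"
      by (intro tendsto_intros tail_bound_tendsto_0)
    hence "eventually (\<lambda>D. C * tail_bound D < \<epsilon>) sequentially"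
      using \<open>\<epsilon> > 0\<close> by (intro order_tendstoD(2)) auto
    then obtain D where D: "C * tail_bound D < \<epsilon>" by (auto simp: eventually_sequentially)
    have "\<bar>average (k_normal_density F k) N - average (density_trunc D k) N\<bar> \<le> \<epsilon>" for N
    proof -
      have "\<bar>average (k_normal_density F k) N - average (density_trunc D k) N\<bar> \<le>
              average (\<lambda>n. C * tail_weight D n) N"
        unfolding C_def by (intro abs_average_diff_le density_trunc_error)
      also have "\<dots> = C * average (tail_weight D) N"
        by (simp add: average_def sum_distrib_left)
      also have "\<dots> \<le> C * tail_bound D"
        by (intro mult_left_mono average_tail_weight_le) (simp add: C_def)
      finally show ?thesis using D by simp
    qed
    thus "\<exists>b. convergent b \<and> (\<forall>N. \<bar>average (k_normal_density F k) N - b N\<bar> \<le> \<epsilon>)"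
      using convergent_average_density_trunc by blast
  qed
  then obtain L where L: "average (k_normal_density F k) \<longlonglongrightarrow> L" by (auto simp: convergent_def)
  have "mean_k_normal_density F k = L"
    unfolding mean_k_normal_density_def
    by (rule tendsto_Lim[OF _ average_tendsto_real[OF L]]) simp
  with L show ?thesis by simp
qed

section \<open>Lower bounds for the density of normal elements\<close>

lemma monic_divisors_0: "monic_divisors 0 n = {1}"
proof -
  have "lead_coeff g = 1 \<and> degree g = 0 \<longleftrightarrow> g = 1" for g :: "'f poly"
  proof
    assume g: "lead_coeff g = 1 \<and> degree g = 0"
    hence "degree g = 0" by (rule conjunct2)
    moreover from this have "coeff g 0 = 1" using conjunct1[OF g] by simp
    ultimately show "g = 1" using degree_0_id[of g] by (simp add: one_pCons)
  qed simp
  thus ?thesis unfolding monic_divisors_def by auto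
qed

lemma normal_density_eq:
  assumes "n \<ge> 1"
  shows   "k_normal_density F 0 n = (\<Prod>P | P \<in> monic_irr \<and> P dvd xn1 n. 1 - 1 / real q ^ degree P)"
  by (simp add: k_normal_density_eq[OF assms] monic_divisors_0)

lemma tail_weight_0:
  "tail_weight 0 n = (\<Sum>P | P \<in> monic_irr \<and> P dvd xn1 n. 1 / real q ^ degree P)"
proof -
  have "{P. P \<in> monic_irr \<and> P dvd xn1 n \<and> degree P > 0} = {P. P \<in> monic_irr \<and> P dvd xn1 n}"
    using degree_monic_irr by blast
  thus ?thesis by (simp only: tail_weight_def)
qed

lemma normal_density_ge_linear:
  assumes "n \<ge> 1"
  shows   "k_normal_density F 0 n \<ge> 1 - tail_weight 0 n"
  unfolding normal_density_eq[OF assms] tail_weight_0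
  using weight_bounds by (intro Weierstrass_prod_ineq) force

lemma normal_density_ge_exp:
  assumes "n \<ge> 1"
  shows   "k_normal_density F 0 n \<ge> exp (- 2 * tail_weight 0 n)"
proof -
  have "exp (- 2 * tail_weight 0 n) =
          (\<Prod>P | P \<in> monic_irr \<and> P dvd xn1 n. exp (- 2 * (1 / real q ^ degree P)))"
    unfolding tail_weight_0 sum_distrib_left
    by (rule exp_sum[OF finite_prime_factors(1)[OF assms]])
  also have "\<dots> \<le> (\<Prod>P | P \<in> monic_irr \<and> P dvd xn1 n. 1 - 1 / real q ^ degree P)"
    using weight_bounds by (intro prod_mono conjI exp_neg_double_le) (auto intro: less_imp_le)
  finally show ?thesis by (simp add: normal_density_eq[OF assms])
qed

text \<open>The weights have average at most \<open>B\<close>, so by convexity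
  \<open>exp (- 2 * tail_weight 0 n)\<close> has average at least \<open>exp (- 2 * B)\<close>. The
  linear bound \<open>1 - B\<close> can be negative for small \<open>q\<close>.\<close>

lemma mean_normal_density_pos: "mean_k_normal_density F 0 > 0"
proof -
  define B where "B = tail_bound 0"
  have "average (k_normal_density F 0) N \<ge> exp (- 2 * B)" if "N \<ge> 1" for N
  proof -
    have le: "exp (- 2 * B) * (1 + 2 * B - 2 * tail_weight 0 n) \<le> k_normal_density F 0 n" if "n \<ge> 1" for n
    proof -
      \<comment> \<open>tangent of \<open>exp\<close> at \<open>- 2 B\<close>, as in the proof of Jensen's inequality\<close>
      have "1 + 2 * B - 2 * tail_weight 0 n \<le> exp (2 * B - 2 * tail_weight 0 n)"
        using exp_ge_add_one_self[of "2 * B - 2 * tail_weight 0 n"] by linarith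
      hence "exp (- 2 * B) * (1 + 2 * B - 2 * tail_weight 0 n) \<le>
               exp (- 2 * B) * exp (2 * B - 2 * tail_weight 0 n)"
        by (rule mult_left_mono) simp
      also have "\<dots> = exp (- 2 * tail_weight 0 n)" by (simp flip: exp_add)
      also have "\<dots> \<le> k_normal_density F 0 n" by (rule normal_density_ge_exp[OF that])
      finally show ?thesis .
    qed
    have "(\<Sum>n=1..N. tail_weight 0 n) \<le> real N * B"
      using average_tail_weight_le[of 0 N] that by (simp add: average_def B_def field_simps)
    hence "real N * exp (- 2 * B) \<le>
             exp (- 2 * B) * (real N * (1 + 2 * B) - 2 * (\<Sum>n=1..N. tail_weight 0 n))"
      by (subst mult.commute, intro mult_left_mono) (simp_all add: algebra_simps)
    also have "\<dots> = (\<Sum>n=1..N. exp (- 2 * B) * (1 + 2 * B - 2 * tail_weight 0 n))"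
      by (simp add: sum_distrib_left [symmetric] sum_subtractf)
    also have "\<dots> \<le> (\<Sum>n=1..N. k_normal_density F 0 n)"
      by (intro sum_mono le) simp
    finally show ?thesis using that by (simp add: average_def field_simps)
  qed
  hence "mean_k_normal_density F 0 \<ge> exp (- 2 * B)"
    by (intro LIMSEQ_le_const[OF average_density_tendsto]) blast
  thus ?thesis using exp_gt_zero[of "- 2 * B"] by linarith
qed

section \<open>Passage from normal to k-normal elements\<close>

lemma xn1_CHAR_power: "xn1 (CHAR('f) ^ t * m) = xn1 m ^ (CHAR('f) ^ t)"
proof -
  have "(xn1 m + 1) ^ (CHAR('f) ^ t) = xn1 m ^ (CHAR('f) ^ t) + 1 ^ (CHAR('f) ^ t)"
    by (rule freshmans_dream'[where n = t]) (simp_all add: prime_CHAR)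
  thus ?thesis by (simp add: xn1_def monom_power mult.commute)
qed

lemma xn1_1_dvd: "xn1 1 dvd xn1 m"
proof -
  have "xn1 1 = [:- 1, 1:]" by (simp add: xn1_def monom_altdef one_pCons)
  thus ?thesis by (simp add: poly_eq_0_iff_dvd [symmetric] xn1_def poly_monom)
qed

text \<open>\<open>X^n - 1\<close> is a power of \<open>X^m - 1\<close> and has the same prime
  factors. Of the sum over \<open>g\<close> only the term \<open>(X - 1)^k\<close> is kept; its
  product runs over a subset of these primes, which can only increase it.\<close>

lemma density_ge_normal_density:
  assumes "m \<ge> 1" "k \<le> CHAR('f) ^ t"
  shows   "k_normal_density F k (CHAR('f) ^ t * m) \<ge> k_normal_density F 0 m / real q ^ k"
proof -
  define n where "n = CHAR('f) ^ t * m"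
  have "CHAR('f) ^ t \<ge> 1" using prime_CHAR by (simp add: prime_gt_0_nat Suc_leI)
  hence n: "n \<ge> 1" using assms(1) by (simp add: n_def)
  define g where "g = xn1 1 ^ k"
  have g: "g \<in> monic_divisors k n"
  proof -
    have "lead_coeff g = 1" by (simp only: g_def lead_coeff_power lead_coeff_xn1 order.refl power_one)
    moreover have "degree g = k"
      using xn1_neq_0[of 1] by (simp add: g_def degree_power_eq degree_xn1)
    moreover have "g dvd xn1 1 ^ (CHAR('f) ^ t)"
      unfolding g_def using assms(2) by (rule le_imp_power_dvd)
    hence "g dvd xn1 n"
      unfolding n_def xn1_CHAR_power using dvd_power_same[OF xn1_1_dvd] dvd_trans by blast
    ultimately show ?thesis by (simp add: monic_divisors_def)
  qed
  have w: "0 \<le> 1 - 1 / real q ^ degree P \<and> 1 - 1 / real q ^ degree P \<le> 1" if "P \<in> monic_irr" for P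
    using weight_bounds[OF that] by simp
  have same: "{P. P \<in> monic_irr \<and> P dvd xn1 m} = {P. P \<in> monic_irr \<and> P dvd xn1 n}"
    using prime_elem_monic_irr \<open>CHAR('f) ^ t \<ge> 1\<close>
    unfolding n_def xn1_CHAR_power by (auto simp: prime_elem_dvd_power_iff)
  have "k_normal_density F 0 m = (\<Prod>P | P \<in> monic_irr \<and> P dvd xn1 n. 1 - 1 / real q ^ degree P)"
    by (simp only: normal_density_eq[OF assms(1)] same)
  also have "\<dots> \<le> (\<Prod>P | P \<in> monic_irr \<and> P * g dvd xn1 n. 1 - 1 / real q ^ degree P)"
    using finite_prime_factors(1)[OF n] w
    by (intro prod_le_prod_subset) (auto dest: dvd_mult_left)
  also have "\<dots> \<le> (\<Sum>g\<in>monic_divisors k n.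
                \<Prod>P | P \<in> monic_irr \<and> P * g dvd xn1 n. 1 - 1 / real q ^ degree P)"
    using g finite_monic_divisors w
    by (intro member_le_sum[where f = "\<lambda>g. \<Prod>P | P \<in> monic_irr \<and> P * g dvd xn1 n. 1 - 1 / real q ^ degree P"]
          prod_nonneg) auto
  finally show ?thesis
    unfolding n_def [symmetric] k_normal_density_eq[OF n] by (simp add: divide_right_mono)
qed

text \<open>Among the indices up to \<open>s * N\<close> only the \<open>N\<close> multiples of
  \<open>s\<close> are retained, which costs the factor \<open>1 / s\<close>; the limit is taken
  along the subsequence \<open>s * N\<close>.\<close>

lemma mean_density_ge:
  assumes "k \<le> CHAR('f) ^ t"
  shows   "mean_k_normal_density F k \<ge>
             mean_k_normal_density F 0 / (real CHAR('f) ^ t * real q ^ k)"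
proof -
  define s where "s = CHAR('f) ^ t"
  have s: "s > 0" using prime_CHAR by (simp add: s_def prime_gt_0_nat)
  have le: "average (k_normal_density F 0) N / (real s * real q ^ k) \<le>
               average (k_normal_density F k) (s * N)" for N
  proof -
    have "(\<Sum>m=1..N. k_normal_density F 0 m / real q ^ k) \<le> (\<Sum>m=1..N. k_normal_density F k (s * m))"
      unfolding s_def using assms by (intro sum_mono density_ge_normal_density) simp
    also have "\<dots> = (\<Sum>n\<in>(\<lambda>m. s * m) ` {1..N}. k_normal_density F k n)"
      using s by (subst sum.reindex) (auto simp: inj_on_def)
    also have "\<dots> \<le> (\<Sum>n=1..s * N. k_normal_density F k n)"
      using s by (intro sum_mono2) (auto simp: k_normal_density_def Suc_le_eq)
    finally have "(\<Sum>m=1..N. k_normal_density F 0 m) / real q ^ k \<le> (\<Sum>n=1..s * N. k_normal_density F k n)"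
      by (simp add: sum_divide_distrib)
    hence "(\<Sum>m=1..N. k_normal_density F 0 m) / real q ^ k / real (s * N) \<le>
             (\<Sum>n=1..s * N. k_normal_density F k n) / real (s * N)"
      by (intro divide_right_mono) simp_all
    thus ?thesis by (simp add: average_def mult_ac)
  qed
  have "strict_mono (\<lambda>N. s * N)" using s by (simp add: strict_mono_def)
  from LIMSEQ_subseq_LIMSEQ[OF average_density_tendsto this]
  have "(\<lambda>N. average (k_normal_density F k) (s * N)) \<longlonglongrightarrow> mean_k_normal_density F k"
    by (simp add: o_def)
  moreover have "(\<lambda>N. average (k_normal_density F 0) N / (real s * real q ^ k)) \<longlonglongrightarrow>
                   mean_k_normal_density F 0 / (real s * real q ^ k)"
    using s by (intro tendsto_intros average_density_tendsto) simp
  ultimately have "mean_k_normal_density F 0 / (real s * real q ^ k) \<le> mean_k_normal_density F k"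
    using le by (intro LIMSEQ_le) auto
  thus ?thesis by (simp add: s_def)
qed

text \<open>
  The constant is \<open>57/64 = 9/8 (1/2 + 1/6 + 1/8)\<close>, where the three summands come from
  \<open>j = 2\<close>, \<open>j = 3\<close> and \<open>j > 3\<close>. What matters is that it is less than 1.
\<close>

lemma tail_sum_from_0_le:
  assumes "q \<ge> 4"
  shows   "(\<Sum>j\<in>{0<..N}. gcd_mean (q ^ j - 1) / (real j * real q ^ j)) \<le>
             (gcd_mean (q - 1) + 57 / 64) / real q"
proof -
  define f where "f = (\<lambda>j. gcd_mean (q ^ j - 1) / (real j * real q ^ j))"
  define x where "x = 1 / sqrt (real q)"
  have f_nonneg: "f j \<ge> 0" for j by (simp add: f_def gcd_mean_nonneg)
  have "sqrt (real q) \<ge> sqrt 4" using assms by (intro real_sqrt_le_mono) simp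
  hence sq: "sqrt (real q) \<ge> 2" by simp
  have x: "0 < x" "x \<le> 1 / 2" "x\<^sup>2 = 1 / real q"
    using sq by (simp_all add: x_def field_simps power_divide)
  \<comment> \<open>An inequality, so that \<open>N < 3\<close> is covered as well: the extra terms
    are nonnegative.\<close>
  have "(\<Sum>j\<in>{0<..N}. f j) \<le> (\<Sum>j\<in>{1, 2, 3} \<union> {3<..N}. f j)"
    by (intro sum_mono2) (auto simp: f_nonneg)
  also have "\<dots> = f 1 + f 2 + f 3 + (\<Sum>j\<in>{3<..N}. f j)"
    by (subst sum.union_disjoint) simp_all
  finally have split: "(\<Sum>j\<in>{0<..N}. f j) \<le> f 1 + f 2 + f 3 + (\<Sum>j\<in>{3<..N}. f j)" .
  have f: "f j \<le> 9 / 8 * x ^ j / real j" if "j \<ge> 1" for j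
    unfolding f_def x_def by (rule average_tail_term_le[OF that])
  have f2: "f 2 \<le> 9 / 8 * x ^ 2 / 2"
    using f[of 2] by simp
  have "f 3 \<le> 9 / 8 * x ^ 3 / 3"
    using f[of 3] by simp
  also have "x ^ 3 = x * x ^ 2" by (simp add: power2_eq_square power3_eq_cube)
  also have "x * x ^ 2 \<le> 1 / 2 * x ^ 2" using x by (intro mult_right_mono) auto
  finally have f3: "f 3 \<le> 9 / 8 * x ^ 2 / 6" by simp
  have "(\<Sum>j\<in>{3<..N}. f j) \<le> 9 / 8 * (x ^ 4 / (1 - x)) / 4"
    using average_tail_sum_le[where D = 3 and N = N] by (simp add: f_def x_def tail_bound_def)
  also have "x ^ 4 / (1 - x) \<le> (1 / 4 * x ^ 2) / (1 / 2)"
  proof (rule frac_le)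
    have "x ^ 2 \<le> (1 / 2) ^ 2" using x by (intro power_mono) auto
    hence "x ^ 2 * x ^ 2 \<le> 1 / 4 * x ^ 2" by (intro mult_right_mono) (simp_all add: power2_eq_square)
    thus "x ^ 4 \<le> 1 / 4 * x ^ 2" by (simp flip: power_add)
  qed (use x in auto)
  finally have f4: "(\<Sum>j\<in>{3<..N}. f j) \<le> 9 / 8 * x ^ 2 / 8" by simp
  \<comment> \<open>The term \<open>j = 1\<close> is kept exactly, since the factor
    \<open>9/8\<close> of the general estimate would be too large here.\<close>
  have "f 1 = gcd_mean (q - 1) / real q" by (simp add: f_def)
  with split f2 f3 f4 have "(\<Sum>j\<in>{0<..N}. f j) \<le> gcd_mean (q - 1) / real q + 57 / 64 * x ^ 2"
    by linarith
  thus ?thesis by (simp add: f_def x(3) add_divide_distrib)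
qed

lemma mean_normal_density_gt:
  assumes "q \<ge> 4"
  shows   "mean_k_normal_density F 0 > 1 - 1 / sqrt (real q) - 1 / real q"
proof -
  define W where "W = (gcd_mean (q - 1) + 57 / 64) / real q"
  have ge: "average (k_normal_density F 0) N \<ge> 1 - W" if "N \<ge> 1" for N
  proof -
    have "(\<Sum>n=1..N. tail_weight 0 n) \<le>
            real N * (\<Sum>j\<in>{0<..N}. gcd_mean (q ^ j - 1) / (real j * real q ^ j))"
      by (rule sum_tail_weight_le)
    also have "\<dots> \<le> real N * W"
      unfolding W_def by (intro mult_left_mono tail_sum_from_0_le assms) simp
    finally have "real N * (1 - W) \<le> (\<Sum>n=1..N. 1 - tail_weight 0 n)"
      by (simp add: sum_subtractf algebra_simps)
    also have "\<dots> \<le> (\<Sum>n=1..N. k_normal_density F 0 n)"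
      by (intro sum_mono normal_density_ge_linear) simp
    finally have "(1 - W) * real N \<le> (\<Sum>n=1..N. k_normal_density F 0 n)"
      by (simp only: mult.commute)
    thus ?thesis unfolding average_def using that by (subst pos_le_divide_eq) simp_all
  qed
  have "\<forall>N\<ge>1. 1 - W \<le> average (k_normal_density F 0) N" using ge by simp
  hence mean: "mean_k_normal_density F 0 \<ge> 1 - W"
    using LIMSEQ_le_const[OF average_density_tendsto] by metis
  \<comment> \<open>It suffices that \<open>gcd_mean (q - 1)\<close> is at most
    \<open>sqrt q\<close>. For \<open>q \<ge> 4\<close> the exceptions of
    \<open>gcd_mean_sq_le\<close> leave only \<open>q = 7\<close>.\<close>
  have "gcd_mean (q - 1) + 57 / 64 < sqrt (real q) + 1"
  proof (cases "q = 7")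
    case True
    have "5 / 2 \<le> sqrt (real q)"
      by (rule real_le_rsqrt) (simp add: True power2_eq_square)
    thus ?thesis by (simp add: True gcd_mean_6)
  next
    case False
    have "(gcd_mean (q - 1))\<^sup>2 \<le> real (q - 1)"
      using assms False by (intro gcd_mean_sq_le) auto
    also have "\<dots> \<le> real q" by simp
    finally have "gcd_mean (q - 1) \<le> sqrt (real q)" by (rule real_le_rsqrt)
    thus ?thesis by simp
  qed
  hence "W < (sqrt (real q) + 1) / real q"
    unfolding W_def by (intro divide_strict_right_mono) simp_all
  also have "\<dots> = 1 / sqrt (real q) + 1 / real q"
    by (simp add: add_divide_distrib sqrt_divide_self_eq inverse_eq_divide)
  finally show ?thesis using mean by simp
qed

end

theorem corollary1p2:
  fixes p q r k t :: nat
  assumes "prime p" and "r \<ge> 1" and "q = p ^ r"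
    and "CARD('f :: finite_field) = q"
    and "t = (if k > 0 then nat \<lfloor>log (real p) (real k)\<rfloor> + 1 else 0)"
  shows "mean_k_normal_density TYPE('f) k \<ge> mean_k_normal_density TYPE('f) 0 / (real p ^ t * real q ^ k)
    \<and> mean_k_normal_density TYPE('f) 0 / (real p ^ t * real q ^ k) > 0
    \<and> (q \<ge> 4 \<longrightarrow> mean_k_normal_density TYPE('f) 0 > 1 - 1 / sqrt (real q) - 1 / real q)"
proof -
  have char: "CHAR('f) = p"
    using assms(1,3,4) by (intro CARD_eq_power_imp_CHAR_eq) simp_all
  interpret finite_base_field "TYPE('f)" q r
    by standard (use assms char in simp_all)
  have p: "p > 1" using assms(1) by (rule prime_gt_1_nat)
  \<comment> \<open>For \<open>k > 0\<close> the exponent \<open>t\<close> exceeds the logarithm of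
    \<open>k\<close>, so \<open>p ^ t > k\<close>; for \<open>k = 0\<close> it is 0. This makes
    \<open>(X - 1)^k\<close> divide \<open>(X - 1)^(p^t)\<close>.\<close>
  have "k \<le> p ^ t"
  proof (cases "k = 0")
    case False
    have "log (real p) (real k) < real t"
      using False p assms(5) by (simp add: zero_le_log_cancel_iff) linarith
    hence "real k < real p powr real t"
      using False p by (simp add: log_less_iff)
    hence "real k < real (p ^ t)" using p by (simp add: powr_realpow)
    thus ?thesis by simp
  qed simp
  hence "mean_k_normal_density TYPE('f) k \<ge> mean_k_normal_density TYPE('f) 0 / (real p ^ t * real q ^ k)"
    using mean_density_ge[of k t] by (simp add: char)
  moreover have "mean_k_normal_density TYPE('f) 0 / (real p ^ t * real q ^ k) > 0"
    using mean_normal_density_pos p by (intro divide_pos_pos mult_pos_pos) simp_all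
  ultimately show ?thesis using mean_normal_density_gt by blast
qed

end
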